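(* Let $G$ and $G'$ be countable directed graphs. There exists a bicontinuous algebra isomorphism $\tau:\mathcal{T}_+(G)\to\mathcal{T}_+(G')$ (i.e. $\mathcal{T}_+(G)$ and $\mathcal{T}_+(G')$ are isomorphic as Banach algebras) if and only if the graphs $G$ and $G'$ are isomorphic.
   Context: A countable directed graph $G$ has countable vertex set $\mathcal{V}(G)$, countable edge set $\mathcal{E}(G)$, and range and source maps $r,s:\mathcal{E}(G)\to\mathcal{V}(G)$ (multiple edges and loop edges allowed). Two graphs are isomorphic if there are bijections between their vertex sets and their edge sets intertwining the range and source maps. The free semigroupoid $\mathbb{F}^+(G)$ consists of all vertices (paths of length $0$, with $r(v)=s(v)=v$) and all finite paths $w=e_k\cdots e_1$ with $e_i\in\mathcal{E}(G)$, $s(e_i)=r(e_{i-1})$; here $|w|=k$, $s(w)=s(e_1)$, $r(w)=r(e_k)$. Let $\mathcal{H}_G=\ell^2(\mathbb{F}^+(G))$ with orthonormal basis $\{\xi_w\}_{w\in\mathbb{F}^+(G)}$. For $e\in\mathcal{E}(G)$ the left creation operator $L_e$ is defined by $L_e\xi_w=\xi_{ew}$ if $s(e)=r(w)$ and $L_e\xi_w=0$ otherwise; for $v\in\mathcal{V}(G)$, $P_v$ is the orthogonal projection onto $\overline{\operatorname{span}}\{\xi_w: r(w)=v\}$. The tensor algebra $\mathcal{T}_+(G)$ is the norm-closed operator algebra on $\mathcal{H}_G$ generated by $\{L_e\}_{e\in\mathcal{E}(G)}\cup\{P_v\}_{v\in\mathcal{V}(G)}$ (equivalently, the norm-closed subalgebra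 generated by the canonical partial isometries and projections in the universal Toeplitz $C^*$-algebra of $G$). *)

theory Defs
  imports "HOL-Analysis.Analysis" "HOL-Library.Countable_Set" "HOL-Library.Function_Algebras"
begin

definition countable_digraph :: "'v set \<Rightarrow> 'e set \<Rightarrow> ('e \<Rightarrow> 'v) \<Rightarrow> ('e \<Rightarrow> 'v) \<Rightarrow> bool" where
  "countable_digraph V E r s \<longleftrightarrow> countable V \<and> countable E \<and> r ` E \<subseteq> V \<and> s ` E \<subseteq> V"

definition graph_iso ::
  "'v set \<Rightarrow> 'e set \<Rightarrow> ('e \<Rightarrow> 'v) \<Rightarrow> ('e \<Rightarrow> 'v) \<Rightarrow>
   'w set \<Rightarrow> 'f set \<Rightarrow> ('f \<Rightarrow> 'w) \<Rightarrow> ('f \<Rightarrow> 'w) \<Rightarrow> bool" where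
  "graph_iso V E r s V' E' r' s' \<longleftrightarrow>
     (\<exists>\<phi> \<psi>. bij_betw \<phi> V V' \<and> bij_betw \<psi> E E' \<and>
        (\<forall>e\<in>E. r' (\<psi> e) = \<phi> (r e) \<and> s' (\<psi> e) = \<phi> (s e)))"

text \<open>Elements of the free semigroupoid: a vertex, or a nonempty path
  Px [e_k, ..., e_1] (the list is written in the order of the word
  e_k ... e_1, so the head of the list is the last edge traversed).\<close>

datatype ('v, 'e) gpath = Vx 'v | Px "'e list"

fun prange :: "('e \<Rightarrow> 'v) \<Rightarrow> ('v, 'e) gpath \<Rightarrow> 'v" where
  "prange r (Vx v) = v"
| "prange r (Px es) = r (hd es)"

definition paths :: "'v set \<Rightarrow> 'e set \<Rightarrow> ('e \<Rightarrow> 'v) \<Rightarrow> ('e \<Rightarrow> 'v) \<Rightarrow> ('v, 'e) gpath set" where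
  "paths V E r s = Vx ` V \<union>
     Px ` {es. es \<noteq> [] \<and> set es \<subseteq> E \<and>
               (\<forall>i. Suc i < length es \<longrightarrow> s (es ! i) = r (es ! Suc i))}"

fun ptail :: "('e \<Rightarrow> 'v) \<Rightarrow> ('v, 'e) gpath \<Rightarrow> ('v, 'e) gpath" where
  "ptail s (Px [e]) = Vx (s e)"
| "ptail s (Px (e # es)) = Px es"
| "ptail s p = p"

definition ell2 :: "'a set \<Rightarrow> ('a \<Rightarrow> complex) set" where
  "ell2 A = {x. (\<forall>w. w \<notin> A \<longrightarrow> x w = 0) \<and> (\<lambda>w. (cmod (x w))\<^sup>2) summable_on A}"

definition norm2 :: "('a \<Rightarrow> complex) \<Rightarrow> real" where
  "norm2 x = sqrt (infsum (\<lambda>w. (cmod (x w))\<^sup>2) UNIV)"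

text \<open>Bounded linear operators on l^2(A), normalised to be 0 outside l^2(A)
  so that equality of operators is equality of functions.\<close>
definition bop :: "'a set \<Rightarrow> (('a \<Rightarrow> complex) \<Rightarrow> ('a \<Rightarrow> complex)) set" where
  "bop A = {T. (\<forall>x\<in>ell2 A. T x \<in> ell2 A) \<and>
               (\<forall>x\<in>ell2 A. \<forall>y\<in>ell2 A. T (x + y) = T x + T y) \<and>
               (\<forall>c. \<forall>x\<in>ell2 A. T (\<lambda>w. c * x w) = (\<lambda>w. c * T x w)) \<and>
               (\<exists>C. \<forall>x\<in>ell2 A. norm2 (T x) \<le> C * norm2 x) \<and>
               (\<forall>x. x \<notin> ell2 A \<longrightarrow> T x = 0)}"

definition opnorm :: "'a set \<Rightarrow> (('a \<Rightarrow> complex) \<Rightarrow> ('a \<Rightarrow> complex)) \<Rightarrow> real" where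
  "opnorm A T = Sup {norm2 (T x) | x. x \<in> ell2 A \<and> norm2 x \<le> 1}"

definition op_add where "op_add T S = (\<lambda>x. T x + S x)"
definition op_scale where "op_scale (c::complex) T = (\<lambda>x w. c * T x w)"
definition op_diff where "op_diff T S = (\<lambda>x. T x - S x)"

inductive_set alg_gen :: "(('a \<Rightarrow> complex) \<Rightarrow> ('a \<Rightarrow> complex)) set \<Rightarrow>
    (('a \<Rightarrow> complex) \<Rightarrow> ('a \<Rightarrow> complex)) set" for Gs where
  gen: "T \<in> Gs \<Longrightarrow> T \<in> alg_gen Gs"
| zero: "(\<lambda>x. 0) \<in> alg_gen Gs"
| add: "T \<in> alg_gen Gs \<Longrightarrow> S \<in> alg_gen Gs \<Longrightarrow> op_add T S \<in> alg_gen Gs"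
| scale: "T \<in> alg_gen Gs \<Longrightarrow> op_scale c T \<in> alg_gen Gs"
| mult: "T \<in> alg_gen Gs \<Longrightarrow> S \<in> alg_gen Gs \<Longrightarrow> T \<circ> S \<in> alg_gen Gs"

definition norm_closure where
  "norm_closure A S = {T \<in> bop A. \<forall>\<epsilon>>0. \<exists>S'\<in>S. opnorm A (op_diff T S') < \<epsilon>}"

definition Lop :: "'v set \<Rightarrow> 'e set \<Rightarrow> ('e \<Rightarrow> 'v) \<Rightarrow> ('e \<Rightarrow> 'v) \<Rightarrow> 'e \<Rightarrow>
    (('v, 'e) gpath \<Rightarrow> complex) \<Rightarrow> (('v, 'e) gpath \<Rightarrow> complex)" where
  "Lop V E r s e x =
     (if x \<in> ell2 (paths V E r s) then
        (\<lambda>u. if u \<in> paths V E r s \<and> (\<exists>es. u = Px (e # es)) then x (ptail s u) else 0)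
      else 0)"

definition Pop :: "'v set \<Rightarrow> 'e set \<Rightarrow> ('e \<Rightarrow> 'v) \<Rightarrow> ('e \<Rightarrow> 'v) \<Rightarrow> 'v \<Rightarrow>
    (('v, 'e) gpath \<Rightarrow> complex) \<Rightarrow> (('v, 'e) gpath \<Rightarrow> complex)" where
  "Pop V E r s v x =
     (if x \<in> ell2 (paths V E r s) then
        (\<lambda>u. if u \<in> paths V E r s \<and> prange r u = v then x u else 0)
      else 0)"

definition tensor_alg :: "'v set \<Rightarrow> 'e set \<Rightarrow> ('e \<Rightarrow> 'v) \<Rightarrow> ('e \<Rightarrow> 'v) \<Rightarrow>
    ((('v, 'e) gpath \<Rightarrow> complex) \<Rightarrow> (('v, 'e) gpath \<Rightarrow> complex)) set" where
  "tensor_alg V E r s = norm_closure (paths V E r s)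
      (alg_gen (Lop V E r s ` E \<union> Pop V E r s ` V))"

definition op_continuous_on where
  "op_continuous_on A B X f \<longleftrightarrow>
     (\<forall>T\<in>X. \<forall>\<epsilon>>0. \<exists>\<delta>>0. \<forall>S\<in>X. opnorm A (op_diff S T) < \<delta> \<longrightarrow>
        opnorm B (op_diff (f S) (f T)) < \<epsilon>)"

definition bicont_alg_iso where
  "bicont_alg_iso A B X Y \<tau> \<longleftrightarrow>
     bij_betw \<tau> X Y \<and>
     (\<forall>T\<in>X. \<forall>S\<in>X. \<tau> (op_add T S) = op_add (\<tau> T) (\<tau> S)) \<and>
     (\<forall>c. \<forall>T\<in>X. \<tau> (op_scale c T) = op_scale c (\<tau> T)) \<and>
     (\<forall>T\<in>X. \<forall>S\<in>X. \<tau> (T \<circ> S) = \<tau> T \<circ> \<tau> S) \<and>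
     op_continuous_on A B X \<tau> \<and>
     op_continuous_on B A Y (the_inv_into X \<tau>)"

end

theory Submission
  imports Defs "HOL-Complex_Analysis.Conformal_Mappings"
begin

text \<open>An algebra isomorphism pulls characters back to characters and point derivations back to point
  derivations. A character of \<open>\<T>\<^sub>+(G)\<close> equals 1 on exactly one \<open>P\<^sub>v\<close>, and on idempotents it then
  agrees with the vacuum character \<open>T \<mapsto> \<langle>T \<xi>\<^sub>v, \<xi>\<^sub>v\<rangle>\<close>; applied to the images of the \<open>P\<^sub>v\<close> this
  gives a bijection of the vertices. The edges from \<open>v\<close> to \<open>w\<close> give linearly independent derivations
  \<open>T \<mapsto> \<langle>T \<xi>\<^sub>v, \<xi>\<^sub>e\<rangle>\<close> between the vacuum characters at \<open>w\<close> and \<open>v\<close>, while between any two characters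
  at \<open>w\<close> and \<open>v\<close> there are, modulo inner ones, at most as many independent derivations as edges.
  Hence the numbers of edges agree. Conversely, a graph isomorphism induces a unitary between the path
  spaces that intertwines the generators.\<close>

section \<open>Square-summable functions\<close>

text \<open>Loops are the obstacle. If there are loops at \<open>v\<close>, the characters that
  equal 1 on \<open>P v\<close> fill a whole ball, and an isomorphism may move a vacuum character
  away from its centre, so vacuum characters cannot simply be matched with one another. Idempotents
  do not see the position in the ball: the gauge circle rotates characters about the centre, and a
  continuous 0-1 valued function cannot vary along it. For the same reason the upper bound on
  derivations is proved at arbitrary characters; the lower bound is wanted only at vacuum ones,
  because what gets pulled back are the vacuum data of the target graph. When the two vertices
  differ, the derivations carry one extra dimension, spanned by the difference of the two
  characters; its value on a vertex projection separates it from the edge derivations, which vanish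
  there. Multiplicities are compared through finite sets of edges, once along the isomorphism and
  once along its inverse; countability settles the infinite case.\<close>

lemma ell2_iff:
  "x \<in> ell2 A \<longleftrightarrow> (\<forall>w. w \<notin> A \<longrightarrow> x w = 0) \<and> (\<lambda>w. (cmod (x w))\<^sup>2) summable_on UNIV"
proof (cases "\<forall>w. w \<notin> A \<longrightarrow> x w = 0")
  case True
  have "(\<lambda>w. (cmod (x w))\<^sup>2) summable_on A \<longleftrightarrow> (\<lambda>w. (cmod (x w))\<^sup>2) summable_on UNIV"
    by (rule summable_on_cong_neutral) (use True in auto)
  then show ?thesis using True by (simp add: ell2_def)
qed (auto simp: ell2_def)

lemma ell2_outside: "x \<in> ell2 A \<Longrightarrow> w \<notin> A \<Longrightarrow> x w = 0"
  by (simp add: ell2_iff)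

lemma norm2_nonneg [simp]: "0 \<le> norm2 x"
  by (simp add: norm2_def infsum_nonneg)

lemma L2_set_le_norm2:
  assumes "x \<in> ell2 A" "finite F"
  shows "L2_set (\<lambda>w. cmod (x w)) F \<le> norm2 x"
  unfolding L2_set_def norm2_def
  by (intro real_sqrt_le_mono finite_sum_le_infsum) (use assms in \<open>auto simp: ell2_iff\<close>)

text \<open>A uniform bound over finite sets yields summability and the norm bound together, so
  estimates for \<open>norm2\<close>, such as the triangle inequality, are inherited from the finite
  \<open>L2_set\<close>.\<close>

lemma L2_set_bound_ell2:
  assumes supp: "\<And>w. w \<notin> A \<Longrightarrow> x w = 0"
    and bd: "\<And>F. finite F \<Longrightarrow> L2_set (\<lambda>w. cmod (x w)) F \<le> M"
  shows "x \<in> ell2 A" "norm2 x \<le> M"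
proof -
  have M: "0 \<le> M" using bd[of "{}"] by simp
  have b: "(\<Sum>w\<in>F. (cmod (x w))\<^sup>2) \<le> M\<^sup>2" if "finite F" for F
    using bd[OF that] sqrt_le_D unfolding L2_set_def by blast
  have s: "(\<lambda>w. (cmod (x w))\<^sup>2) summable_on UNIV"
    by (rule nonneg_bdd_above_summable_on) (use b in \<open>auto simp: bdd_above_def\<close>)
  then show "x \<in> ell2 A" using supp by (simp add: ell2_iff)
  have "infsum (\<lambda>w. (cmod (x w))\<^sup>2) UNIV \<le> M\<^sup>2"
    by (rule infsum_le_finite_sums[OF s]) (use b in auto)
  then show "norm2 x \<le> M"
    unfolding norm2_def using M by (simp add: real_le_lsqrt)
qed

lemma cmod_le_norm2: "x \<in> ell2 A \<Longrightarrow> cmod (x w) \<le> norm2 x"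
  using L2_set_le_norm2[of x A "{w}"] by simp

lemma ell2_add_norm2:
  assumes "x \<in> ell2 A" "y \<in> ell2 A"
  shows "x + y \<in> ell2 A" "norm2 (x + y) \<le> norm2 x + norm2 y"
proof -
  have *: "L2_set (\<lambda>w. cmod ((x + y) w)) F \<le> norm2 x + norm2 y" if "finite F" for F
  proof -
    have "L2_set (\<lambda>w. cmod ((x + y) w)) F \<le> L2_set (\<lambda>w. cmod (x w) + cmod (y w)) F"
      by (rule L2_set_mono) (auto simp: norm_triangle_ineq)
    also have "\<dots> \<le> L2_set (\<lambda>w. cmod (x w)) F + L2_set (\<lambda>w. cmod (y w)) F"
      by (rule L2_set_triangle_ineq)
    finally show ?thesis
      using L2_set_le_norm2[OF assms(1) that] L2_set_le_norm2[OF assms(2) that] by linarith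
  qed
  show "x + y \<in> ell2 A" "norm2 (x + y) \<le> norm2 x + norm2 y"
    by (rule L2_set_bound_ell2[OF _ *, of A], use assms in \<open>auto simp: ell2_outside\<close>)+
qed

text \<open>The operators \<open>L\<^sub>e\<close> and \<open>P\<^sub>v\<close>, the gauge unitaries and the unitaries that come from graph
  isomorphisms are all weighted composition operators of this form.\<close>

definition wcomp :: "'b set \<Rightarrow> ('b \<Rightarrow> 'a) \<Rightarrow> ('b \<Rightarrow> complex) \<Rightarrow> ('a \<Rightarrow> complex) \<Rightarrow> 'b \<Rightarrow> complex" where
  "wcomp S g c x = (\<lambda>u. if u \<in> S then c u * x (g u) else 0)"

lemma wcomp_add: "wcomp S g c (x + y) = wcomp S g c x + wcomp S g c y"
  by (auto simp: wcomp_def fun_eq_iff algebra_simps)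

lemma wcomp_scale: "wcomp S g c (\<lambda>w. a * x w) = (\<lambda>w. a * wcomp S g c x w)"
  by (auto simp: wcomp_def fun_eq_iff)

text \<open>Since \<open>g\<close> is injective on \<open>S\<close>, each coefficient of
  \<open>x\<close> is read at most once, and the weights do not enlarge it.\<close>

lemma wcomp_ell2:
  assumes x: "x \<in> ell2 A" and S: "S \<subseteq> B" "inj_on g S" and c: "\<And>u. u \<in> S \<Longrightarrow> cmod (c u) \<le> 1"
  shows "wcomp S g c x \<in> ell2 B" "norm2 (wcomp S g c x) \<le> norm2 x"
proof -
  have *: "L2_set (\<lambda>w. cmod (wcomp S g c x w)) F \<le> norm2 x" if "finite F" for F
  proof -
    have "(\<Sum>w\<in>F. (cmod (wcomp S g c x w))\<^sup>2) = (\<Sum>w\<in>F \<inter> S. (cmod (wcomp S g c x w))\<^sup>2)"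
      by (rule sum.mono_neutral_right) (use that in \<open>auto simp: wcomp_def\<close>)
    also have "\<dots> \<le> (\<Sum>w\<in>F \<inter> S. (cmod (x (g w)))\<^sup>2)"
      by (intro sum_mono power_mono)
        (use c in \<open>auto simp: wcomp_def norm_mult intro: mult_left_le_one_le\<close>)
    also have "\<dots> = (\<Sum>w\<in>g ` (F \<inter> S). (cmod (x w))\<^sup>2)"
      using S(2) by (subst sum.reindex) (auto intro: inj_on_subset)
    finally have "L2_set (\<lambda>w. cmod (wcomp S g c x w)) F \<le> L2_set (\<lambda>w. cmod (x w)) (g ` (F \<inter> S))"
      unfolding L2_set_def by (rule real_sqrt_le_mono)
    also have "\<dots> \<le> norm2 x" by (rule L2_set_le_norm2[OF x]) (use that in auto)
    finally show ?thesis .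
  qed
  show "wcomp S g c x \<in> ell2 B" "norm2 (wcomp S g c x) \<le> norm2 x"
    using S(1) by (auto intro!: L2_set_bound_ell2[OF _ *, of B]) (auto simp: wcomp_def)
qed

lemma norm2_scale: "norm2 (\<lambda>w. c * x w) = cmod c * norm2 x"
  by (simp add: norm2_def norm_mult power_mult_distrib infsum_cmult_right' real_sqrt_mult)

lemma ell2_scale: "x \<in> ell2 A \<Longrightarrow> (\<lambda>w. c * x w) \<in> ell2 A"
  by (auto simp: ell2_iff norm_mult power_mult_distrib intro: summable_on_cmult_right)

lemma ell2_zero [simp]: "0 \<in> ell2 A" "(\<lambda>w. 0) \<in> ell2 A"
  by (auto simp: ell2_iff zero_fun_def)

lemma norm2_zero [simp]: "norm2 0 = 0" "norm2 (\<lambda>w. 0) = 0"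
  by (auto simp: norm2_def zero_fun_def)

lemma norm2_uminus: "norm2 (- x) = norm2 x"
  by (simp add: norm2_def)

lemma ell2_uminus: "x \<in> ell2 A \<Longrightarrow> - x \<in> ell2 A"
  by (simp add: ell2_iff)

lemma ell2_diff_norm2:
  assumes "x \<in> ell2 A" "y \<in> ell2 A"
  shows "x - y \<in> ell2 A" "norm2 (x - y) \<le> norm2 x + norm2 y"
  using ell2_add_norm2[OF assms(1) ell2_uminus[OF assms(2)]] by (simp_all add: norm2_uminus)

lemma norm2_eq_0: "x \<in> ell2 A \<Longrightarrow> norm2 x = 0 \<Longrightarrow> x = 0"
  using cmod_le_norm2[of x A] by (fastforce simp: fun_eq_iff)

text \<open>The orthonormal basis vector \<xi>_w.\<close>

definition ket :: "'a \<Rightarrow> 'a \<Rightarrow> complex" where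
  "ket w = (\<lambda>u. if u = w then 1 else 0)"

lemma ket_ell2: "w \<in> A \<Longrightarrow> ket w \<in> ell2 A" and norm2_ket: "norm2 (ket w) = 1"
proof -
  have *: "((\<lambda>u. (cmod (ket w u))\<^sup>2) has_sum 1) UNIV"
    using has_sum_finite_neutralI[of "{w}" UNIV "\<lambda>u. (cmod (ket w u))\<^sup>2" 1] by (simp add: ket_def)
  show "w \<in> A \<Longrightarrow> ket w \<in> ell2 A"
    using has_sum_imp_summable[OF *] by (auto simp: ell2_iff ket_def)
  show "norm2 (ket w) = 1" using infsumI[OF *] by (simp add: norm2_def)
qed

section \<open>Bounded operators\<close>

lemma bopI:
  assumes "\<And>x. x \<in> ell2 A \<Longrightarrow> T x \<in> ell2 A"
    and "\<And>x y. x \<in> ell2 A \<Longrightarrow> y \<in> ell2 A \<Longrightarrow> T (x + y) = T x + T y"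
    and "\<And>c x. x \<in> ell2 A \<Longrightarrow> T (\<lambda>w. c * x w) = (\<lambda>w. c * T x w)"
    and "\<And>x. x \<in> ell2 A \<Longrightarrow> norm2 (T x) \<le> C * norm2 x"
    and "\<And>x. x \<notin> ell2 A \<Longrightarrow> T x = 0"
  shows "T \<in> bop A"
  using assms unfolding bop_def by blast

lemma
  assumes "T \<in> bop A"
  shows bop_ell2: "x \<in> ell2 A \<Longrightarrow> T x \<in> ell2 A"
    and bop_add: "x \<in> ell2 A \<Longrightarrow> y \<in> ell2 A \<Longrightarrow> T (x + y) = T x + T y"
    and bop_scale: "x \<in> ell2 A \<Longrightarrow> T (\<lambda>w. c * x w) = (\<lambda>w. c * T x w)"
    and bop_bounded: "\<exists>C. \<forall>x\<in>ell2 A. norm2 (T x) \<le> C * norm2 x"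
    and bop_outside: "x \<notin> ell2 A \<Longrightarrow> T x = 0"
  using assms unfolding bop_def by auto

lemma bop_zero: "T \<in> bop A \<Longrightarrow> T 0 = 0"
  using bop_scale[of T A 0 0] by (simp add: zero_fun_def)

text \<open>Holds for every \<open>x\<close> thanks to the default value 0 outside
  \<open>ell2 A\<close>; it discharges the domain conditions when operators are composed.\<close>

lemma bop_in_ell2: "T \<in> bop A \<Longrightarrow> T x \<in> ell2 A"
  by (cases "x \<in> ell2 A") (auto simp: bop_ell2 bop_outside)

lemma bop_diff:
  assumes "T \<in> bop A" "x \<in> ell2 A" "y \<in> ell2 A"
  shows "T (x - y) = T x - T y"
proof -
  have "T x = T (x - y) + T y"
    using bop_add[OF assms(1) ell2_diff_norm2(1)[OF assms(2,3)] assms(3)] by simp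
  then show ?thesis by simp
qed

lemma bop_eqI:
  assumes "T \<in> bop A" "S \<in> bop A" "\<And>x u. x \<in> ell2 A \<Longrightarrow> T x u = S x u"
  shows "T = S"
proof
  fix x show "T x = S x"
    using assms by (cases "x \<in> ell2 A") (auto simp: bop_outside)
qed

lemma wcomp_bop:
  assumes "S \<subseteq> A" "inj_on g S" "\<And>u. u \<in> S \<Longrightarrow> cmod (c u) \<le> 1"
  shows "(\<lambda>x. if x \<in> ell2 A then wcomp S g c x else 0) \<in> bop A"
  by (rule bopI[of _ _ 1])
    (auto simp: wcomp_ell2[OF _ assms] wcomp_add wcomp_scale ell2_add_norm2 ell2_scale)

section \<open>The operator norm and its algebraic inequalities\<close>

lemma opnorm_bdd:
  assumes "T \<in> bop A"
  shows "bdd_above {norm2 (T x) | x. x \<in> ell2 A \<and> norm2 x \<le> 1}"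
proof -
  obtain C where C: "\<And>x. x \<in> ell2 A \<Longrightarrow> norm2 (T x) \<le> C * norm2 x"
    using bop_bounded[OF assms] by auto
  have "norm2 (T x) \<le> \<bar>C\<bar>" if "x \<in> ell2 A" "norm2 x \<le> 1" for x
  proof -
    have "C * norm2 x \<le> \<bar>C\<bar> * 1" using that by (intro mult_mono) auto
    then show ?thesis using C[OF that(1)] by simp
  qed
  then show ?thesis by (auto simp: bdd_above_def)
qed

lemma opnorm_nonneg: "T \<in> bop A \<Longrightarrow> 0 \<le> opnorm A T"
  unfolding opnorm_def
  by (rule cSup_upper2[OF _ norm2_nonneg[of "T 0"] opnorm_bdd]) auto

lemma norm2_le_opnorm:
  assumes T: "T \<in> bop A" and x: "x \<in> ell2 A"
  shows "norm2 (T x) \<le> opnorm A T * norm2 x"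
proof (cases "norm2 x = 0")
  case True
  then show ?thesis using norm2_eq_0[OF x] bop_zero[OF T] by simp
next
  case False
  then have n: "norm2 x > 0" using norm2_nonneg[of x] by linarith
  define y where "y = (\<lambda>w. complex_of_real (1 / norm2 x) * x w)"
  have y: "y \<in> ell2 A" "norm2 y = 1"
    unfolding y_def norm2_scale by (rule ell2_scale[OF x]) (use n in \<open>simp add: norm_divide\<close>)
  have "norm2 (T y) \<le> opnorm A T"
    unfolding opnorm_def by (rule cSup_upper[OF _ opnorm_bdd[OF T]]) (use y in auto)
  moreover have "norm2 (T y) = 1 / norm2 x * norm2 (T x)"
    using n bop_scale[OF T x, of "complex_of_real (1 / norm2 x)"]
    unfolding y_def by (simp only: norm2_scale norm_of_real) simp
  ultimately show ?thesis using n by (simp add: field_simps)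
qed

lemma opnorm_le:
  assumes "0 \<le> C" "\<And>x. x \<in> ell2 A \<Longrightarrow> norm2 (T x) \<le> C * norm2 x"
  shows "opnorm A T \<le> C"
  unfolding opnorm_def
proof (rule cSup_least)
  show "{norm2 (T x) |x. x \<in> ell2 A \<and> norm2 x \<le> 1} \<noteq> {}" by (auto intro: exI[of _ 0])
  fix a assume "a \<in> {norm2 (T x) |x. x \<in> ell2 A \<and> norm2 x \<le> 1}"
  then obtain x where x: "a = norm2 (T x)" "x \<in> ell2 A" "norm2 x \<le> 1" by auto
  have "C * norm2 x \<le> C * 1" by (intro mult_left_mono) (use x assms in auto)
  then show "a \<le> C" using assms(2)[OF x(2)] x(1) by simp
qed

lemma cmod_le_opnorm:
  assumes "T \<in> bop A" "x \<in> ell2 A"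
  shows "cmod (T x w) \<le> opnorm A T * norm2 x"
  using cmod_le_norm2[OF bop_ell2[OF assms]] norm2_le_opnorm[OF assms] by (rule order_trans)

lemma bop_op_zero: "(\<lambda>x. 0) \<in> bop A"
  by (rule bopI[of _ _ 0]) (auto simp: zero_fun_def)

lemma opnorm_op_zero: "opnorm A (\<lambda>x. 0) = 0"
  by (intro antisym opnorm_nonneg bop_op_zero opnorm_le) auto

lemma bop_op_add_opnorm:
  assumes "T \<in> bop A" "S \<in> bop A"
  shows "op_add T S \<in> bop A" "opnorm A (op_add T S) \<le> opnorm A T + opnorm A S"
proof -
  have n: "norm2 (op_add T S x) \<le> (opnorm A T + opnorm A S) * norm2 x" if "x \<in> ell2 A" for x
    using ell2_add_norm2(2)[OF assms[THEN bop_ell2, OF that]]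
      norm2_le_opnorm[OF assms(1) that] norm2_le_opnorm[OF assms(2) that]
    by (simp add: op_add_def algebra_simps)
  show "op_add T S \<in> bop A"
    by (rule bopI[OF _ _ _ n])
      (use assms in \<open>auto simp: op_add_def ell2_add_norm2 bop_ell2 bop_add bop_scale bop_outside
         algebra_simps fun_eq_iff\<close>)
  show "opnorm A (op_add T S) \<le> opnorm A T + opnorm A S"
    by (rule opnorm_le[OF _ n]) (simp_all add: assms opnorm_nonneg)
qed

lemma bop_op_scale_opnorm:
  assumes "T \<in> bop A"
  shows "op_scale c T \<in> bop A" "opnorm A (op_scale c T) \<le> cmod c * opnorm A T"
proof -
  have n: "norm2 (op_scale c T x) \<le> cmod c * opnorm A T * norm2 x" if "x \<in> ell2 A" for x
    using norm2_le_opnorm[OF assms that] by (simp add: op_scale_def norm2_scale mult_left_mono mult.assoc)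
  show "op_scale c T \<in> bop A"
    by (rule bopI[OF _ _ _ n])
      (use assms in \<open>auto simp: op_scale_def ell2_scale bop_ell2 bop_add bop_scale bop_outside
         algebra_simps fun_eq_iff\<close>)
  show "opnorm A (op_scale c T) \<le> cmod c * opnorm A T"
    by (rule opnorm_le[OF _ n]) (simp_all add: assms opnorm_nonneg)
qed

lemma op_scale_0: "op_scale 0 T = (\<lambda>x. 0)"
  by (simp add: op_scale_def fun_eq_iff)

lemma op_diff_eq: "op_diff T S = op_add T (op_scale (-1) S)"
  by (simp add: op_diff_def op_add_def op_scale_def fun_eq_iff)

lemma bop_op_diff:
  assumes "T \<in> bop A" "S \<in> bop A"
  shows "op_diff T S \<in> bop A"
  by (simp add: op_diff_eq assms bop_op_add_opnorm bop_op_scale_opnorm)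

lemma bop_comp_opnorm:
  assumes "T \<in> bop A" "S \<in> bop A"
  shows "T \<circ> S \<in> bop A" "opnorm A (T \<circ> S) \<le> opnorm A T * opnorm A S"
proof -
  have n: "norm2 ((T \<circ> S) x) \<le> opnorm A T * opnorm A S * norm2 x" if "x \<in> ell2 A" for x
  proof -
    have "norm2 ((T \<circ> S) x) \<le> opnorm A T * norm2 (S x)"
      using norm2_le_opnorm[OF assms(1) bop_ell2[OF assms(2) that]] by simp
    also have "\<dots> \<le> opnorm A T * (opnorm A S * norm2 x)"
      by (intro mult_left_mono norm2_le_opnorm opnorm_nonneg assms that)
    finally show ?thesis by (simp add: mult.assoc)
  qed
  show "T \<circ> S \<in> bop A"
    by (rule bopI[OF _ _ _ n])
      (simp_all only: comp_apply assms bop_ell2 bop_add[OF assms(1)] bop_add[OF assms(2)]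
         bop_scale[OF assms(1)] bop_scale[OF assms(2)] bop_outside[OF assms(2)] bop_zero[OF assms(1)] not_False_eq_True)
  show "opnorm A (T \<circ> S) \<le> opnorm A T * opnorm A S"
    by (rule opnorm_le[OF _ n]) (simp_all add: assms opnorm_nonneg)
qed

lemma cmod_diff_le_opnorm:
  assumes "T \<in> bop A" "S \<in> bop A" "x \<in> ell2 A"
  shows "cmod (T x w - S x w) \<le> opnorm A (op_diff T S) * norm2 x"
  using cmod_le_opnorm[OF bop_op_diff[OF assms(1,2)] assms(3), of w] by (simp add: op_diff_def)

section \<open>Norm-closed operator algebras\<close>

lemma norm_closure_approx:
  assumes "T \<in> norm_closure A S" "\<epsilon> > 0"
  obtains S' where "S' \<in> S" "opnorm A (op_diff T S') < \<epsilon>"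
  using assms unfolding norm_closure_def by blast

lemma norm_closure_bop: "T \<in> norm_closure A S \<Longrightarrow> T \<in> bop A"
  by (simp add: norm_closure_def)

lemma norm_closure_base:
  assumes "S \<subseteq> bop A" "T \<in> S"
  shows "T \<in> norm_closure A S"
proof -
  have "op_diff T T = (\<lambda>x. 0)" by (simp add: op_diff_def fun_eq_iff)
  then show ?thesis using assms by (auto simp: norm_closure_def opnorm_op_zero intro!: bexI[of _ T])
qed

lemma alg_gen_bop: "Gs \<subseteq> bop A \<Longrightarrow> alg_gen Gs \<subseteq> bop A"
proof
  fix T assume "Gs \<subseteq> bop A" "T \<in> alg_gen Gs"
  then show "T \<in> bop A"
    by (induction rule: alg_gen.induct[consumes 1, OF \<open>T \<in> alg_gen Gs\<close>])
      (auto simp: bop_op_zero bop_op_add_opnorm bop_op_scale_opnorm bop_comp_opnorm)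
qed

lemma norm_closure_alg_add:
  assumes G: "Gs \<subseteq> bop A" and T: "T \<in> norm_closure A (alg_gen Gs)" and S: "S \<in> norm_closure A (alg_gen Gs)"
  shows "op_add T S \<in> norm_closure A (alg_gen Gs)"
  unfolding norm_closure_def
proof (intro CollectI conjI allI impI)
  note b = T[THEN norm_closure_bop] S[THEN norm_closure_bop] and ab = alg_gen_bop[OF G]
  show "op_add T S \<in> bop A" using b by (rule bop_op_add_opnorm)
  fix \<epsilon> :: real assume "\<epsilon> > 0"
  then have e: "\<epsilon> / 2 > 0" by simp
  obtain T' where T': "T' \<in> alg_gen Gs" "opnorm A (op_diff T T') < \<epsilon> / 2"
    using norm_closure_approx[OF T e] .
  obtain S' where S': "S' \<in> alg_gen Gs" "opnorm A (op_diff S S') < \<epsilon> / 2"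
    using norm_closure_approx[OF S e] .
  have "op_diff (op_add T S) (op_add T' S') = op_add (op_diff T T') (op_diff S S')"
    by (simp add: op_diff_def op_add_def fun_eq_iff)
  then have "opnorm A (op_diff (op_add T S) (op_add T' S')) \<le> opnorm A (op_diff T T') + opnorm A (op_diff S S')"
    using bop_op_add_opnorm(2)[OF bop_op_diff[OF b(1)] bop_op_diff[OF b(2)], of T' S'] T' S' ab by auto
  then show "\<exists>R\<in>alg_gen Gs. opnorm A (op_diff (op_add T S) R) < \<epsilon>"
    using T' S' by (intro bexI[of _ "op_add T' S'"]) (auto intro: alg_gen.add)
qed

lemma norm_closure_alg_scale:
  assumes G: "Gs \<subseteq> bop A" and T: "T \<in> norm_closure A (alg_gen Gs)"
  shows "op_scale c T \<in> norm_closure A (alg_gen Gs)"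
  unfolding norm_closure_def
proof (intro CollectI conjI allI impI)
  note b = T[THEN norm_closure_bop] and ab = alg_gen_bop[OF G]
  show "op_scale c T \<in> bop A" using b by (rule bop_op_scale_opnorm)
  fix \<epsilon> :: real assume "\<epsilon> > 0"
  then have e: "\<epsilon> / (cmod c + 1) > 0" by (simp add: add_nonneg_pos)
  obtain T' where T': "T' \<in> alg_gen Gs" "opnorm A (op_diff T T') < \<epsilon> / (cmod c + 1)"
    using norm_closure_approx[OF T e] .
  have d: "op_diff T T' \<in> bop A" using b T' ab by (intro bop_op_diff) auto
  have "op_diff (op_scale c T) (op_scale c T') = op_scale c (op_diff T T')"
    by (simp add: op_diff_def op_scale_def fun_eq_iff algebra_simps)
  then have "opnorm A (op_diff (op_scale c T) (op_scale c T')) \<le> cmod c * opnorm A (op_diff T T')"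
    using bop_op_scale_opnorm(2)[OF d] by simp
  also have "\<dots> \<le> (cmod c + 1) * opnorm A (op_diff T T')"
    using opnorm_nonneg[OF d] by (intro mult_right_mono) auto
  also have "\<dots> < \<epsilon>"
    using T'(2) by (simp add: pos_less_divide_eq add_nonneg_pos mult.commute)
  finally show "\<exists>R\<in>alg_gen Gs. opnorm A (op_diff (op_scale c T) R) < \<epsilon>"
    using T' by (intro bexI[of _ "op_scale c T'"]) (auto intro: alg_gen.scale)
qed

lemma norm_closure_alg_comp:
  assumes G: "Gs \<subseteq> bop A" and T: "T \<in> norm_closure A (alg_gen Gs)" and S: "S \<in> norm_closure A (alg_gen Gs)"
  shows "T \<circ> S \<in> norm_closure A (alg_gen Gs)"
  unfolding norm_closure_def
proof (intro CollectI conjI allI impI)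
  note b = T[THEN norm_closure_bop] S[THEN norm_closure_bop] and ab = alg_gen_bop[OF G]
  show "T \<circ> S \<in> bop A" using b by (rule bop_comp_opnorm)
  fix \<epsilon> :: real assume e: "\<epsilon> > 0"
  \<comment> \<open>The estimate rests on TS - T'S' = T(S - S') + (T - T')S'. The approximant
    \<open>S'\<close> is chosen first, because the tolerance for \<open>T'\<close> depends on its
    norm. The summand 1 in \<open>M\<close> and \<open>N\<close> keeps both divisors
    positive.\<close>
  define M where "M = opnorm A T + 1"
  have M: "M > 0" "opnorm A T < M" using opnorm_nonneg[OF b(1)] by (auto simp: M_def)
  have "\<epsilon> / 2 / M > 0" using e M by simp
  then obtain S' where S': "S' \<in> alg_gen Gs" "opnorm A (op_diff S S') < \<epsilon> / 2 / M"
    using norm_closure_approx[OF S] by metis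
  define N where "N = opnorm A S' + 1"
  have bS': "S' \<in> bop A" using S' ab by auto
  have N: "N > 0" "opnorm A S' < N" using opnorm_nonneg[OF bS'] by (auto simp: N_def)
  have "\<epsilon> / 2 / N > 0" using e N by simp
  then obtain T' where T': "T' \<in> alg_gen Gs" "opnorm A (op_diff T T') < \<epsilon> / 2 / N"
    using norm_closure_approx[OF T] by metis
  have bT': "T' \<in> bop A" using T' ab by auto
  note d1 = bop_op_diff[OF b(2) bS'] and d2 = bop_op_diff[OF b(1) bT']
  have "T (S x) - T' (S' x) = T (S x - S' x) + (T (S' x) - T' (S' x))" for x
    using bop_diff[OF b(1) bop_in_ell2[OF b(2)] bop_in_ell2[OF bS']] by simp
  then have "op_diff (T \<circ> S) (T' \<circ> S') = op_add (T \<circ> op_diff S S') (op_diff T T' \<circ> S')"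
    by (simp add: op_diff_def op_add_def fun_eq_iff)
  then have "opnorm A (op_diff (T \<circ> S) (T' \<circ> S'))
      \<le> opnorm A (T \<circ> op_diff S S') + opnorm A (op_diff T T' \<circ> S')"
    using bop_op_add_opnorm(2)[OF bop_comp_opnorm(1)[OF b(1) d1] bop_comp_opnorm(1)[OF d2 bS']] by simp
  also have "\<dots> \<le> opnorm A T * opnorm A (op_diff S S') + opnorm A (op_diff T T') * opnorm A S'"
    by (intro add_mono bop_comp_opnorm b bS' d1 d2)
  also have "\<dots> \<le> M * opnorm A (op_diff S S') + opnorm A (op_diff T T') * N"
    using M N opnorm_nonneg[OF d1] opnorm_nonneg[OF d2]
    by (intro add_mono mult_right_mono mult_left_mono) auto
  also have "\<dots> < \<epsilon> / 2 + \<epsilon> / 2"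
    using S'(2) T'(2) M N by (intro add_strict_mono) (auto simp: field_simps)
  finally show "\<exists>R\<in>alg_gen Gs. opnorm A (op_diff (T \<circ> S) R) < \<epsilon>"
    using T' S' by (intro bexI[of _ "T' \<circ> S'"]) (auto intro: alg_gen.mult)
qed

section \<open>Conjugation by unitaries\<close>

text \<open>T maps to U T U^{-1}, with \<open>W\<close> as the inverse; the case distinction
  restores the default value 0 that membership in \<open>bop B\<close> demands.\<close>

definition unitary_conj where
  "unitary_conj B U W T = (\<lambda>y. if y \<in> ell2 B then U (T (W y)) else 0)"

text \<open>A unitary is encoded as a linear isometry with an explicit two-sided inverse, so no
  inner product has to be introduced.\<close>

locale ell2_unitary =
  fixes A :: "'a set" and B :: "'b set"
    and U :: "('a \<Rightarrow> complex) \<Rightarrow> 'b \<Rightarrow> complex" and W :: "('b \<Rightarrow> complex) \<Rightarrow> 'a \<Rightarrow> complex"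
  assumes U_ell2: "x \<in> ell2 A \<Longrightarrow> U x \<in> ell2 B"
    and W_ell2: "y \<in> ell2 B \<Longrightarrow> W y \<in> ell2 A"
    and WU: "x \<in> ell2 A \<Longrightarrow> W (U x) = x"
    and UW: "y \<in> ell2 B \<Longrightarrow> U (W y) = y"
    and norm_U: "x \<in> ell2 A \<Longrightarrow> norm2 (U x) = norm2 x"
    and U_add: "x \<in> ell2 A \<Longrightarrow> x' \<in> ell2 A \<Longrightarrow> U (x + x') = U x + U x'"
    and U_scale: "x \<in> ell2 A \<Longrightarrow> U (\<lambda>w. c * x w) = (\<lambda>w. c * U x w)"
begin

lemma norm_W: "y \<in> ell2 B \<Longrightarrow> norm2 (W y) = norm2 y"
  using norm_U[OF W_ell2] UW by metis

lemma W_add: "y \<in> ell2 B \<Longrightarrow> y' \<in> ell2 B \<Longrightarrow> W (y + y') = W y + W y'"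
  by (metis U_add UW WU W_ell2 ell2_add_norm2(1))

lemma W_scale: "y \<in> ell2 B \<Longrightarrow> W (\<lambda>w. c * y w) = (\<lambda>w. c * W y w)"
  using WU[OF ell2_scale[OF W_ell2], of y c] by (simp add: U_scale W_ell2 UW)

lemma inverse_unitary: "ell2_unitary B A W U"
  by unfold_locales (simp_all only: U_ell2 W_ell2 WU UW norm_W W_add W_scale)

lemma U_zero: "U 0 = 0"
  using U_scale[of 0 0] by (simp add: zero_fun_def)

abbreviation "cj \<equiv> unitary_conj B U W"

lemma norm_cj:
  assumes "T \<in> bop A" "y \<in> ell2 B"
  shows "norm2 (cj T y) \<le> opnorm A T * norm2 y"
  using norm2_le_opnorm[OF assms(1) W_ell2[OF assms(2)]] assms
  by (simp add: unitary_conj_def norm_U norm_W bop_in_ell2)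

lemma cj_bop:
  assumes "T \<in> bop A"
  shows "cj T \<in> bop B"
  by (rule bopI[OF _ _ _ norm_cj[OF assms]])
    (simp_all only: unitary_conj_def if_True if_False not_False_eq_True assms U_ell2 W_ell2
      bop_ell2 ell2_scale ell2_add_norm2 W_add W_scale
      bop_add[OF assms] bop_scale[OF assms] U_add U_scale)

lemma cj_inverse:
  assumes "T \<in> bop A"
  shows "unitary_conj A W U (cj T) = T"
  by (auto simp: unitary_conj_def fun_eq_iff U_ell2 WU bop_ell2[OF assms] bop_outside[OF assms])

lemma opnorm_cj_le:
  assumes "T \<in> bop A"
  shows "opnorm B (cj T) \<le> opnorm A T"
  by (rule opnorm_le[OF opnorm_nonneg[OF assms] norm_cj[OF assms]])

lemma opnorm_cj:
  assumes "T \<in> bop A"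
  shows "opnorm B (cj T) = opnorm A T"
  using opnorm_cj_le[OF assms] ell2_unitary.opnorm_cj_le[OF inverse_unitary cj_bop[OF assms]]
  by (simp add: cj_inverse assms)

lemma cj_zero: "cj (\<lambda>x. 0) = (\<lambda>x. 0)"
  using U_zero by (simp add: unitary_conj_def fun_eq_iff zero_fun_def)

lemma cj_add:
  assumes "T \<in> bop A" "S \<in> bop A"
  shows "cj (op_add T S) = op_add (cj T) (cj S)"
  by (simp only: unitary_conj_def op_add_def fun_eq_iff U_add bop_in_ell2 assms)
    (simp add: zero_fun_def)

lemma cj_scale:
  assumes "T \<in> bop A"
  shows "cj (op_scale c T) = op_scale c (cj T)"
  by (simp only: unitary_conj_def op_scale_def fun_eq_iff U_scale bop_in_ell2 assms)
    (simp add: zero_fun_def)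

lemma cj_diff:
  assumes "T \<in> bop A" "S \<in> bop A"
  shows "cj (op_diff T S) = op_diff (cj T) (cj S)"
  by (simp add: op_diff_eq cj_add cj_scale assms bop_op_scale_opnorm)

lemma cj_comp:
  assumes "T \<in> bop A" "S \<in> bop A"
  shows "cj (T \<circ> S) = cj T \<circ> cj S"
proof
  fix y show "cj (T \<circ> S) y = (cj T \<circ> cj S) y"
    using bop_zero[OF cj_bop[OF assms(1)]]
    by (auto simp add: unitary_conj_def U_ell2 WU bop_in_ell2 assms)
qed

lemma cj_alg_gen:
  assumes G: "Gs \<subseteq> bop A" and cG: "\<And>T. T \<in> Gs \<Longrightarrow> cj T \<in> alg_gen Hs" and "T \<in> alg_gen Gs"
  shows "cj T \<in> alg_gen Hs"
  using assms(3)
proof induction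
  case (gen T)
  then show ?case by (rule cG)
next
  case zero
  show ?case by (subst cj_zero) (rule alg_gen.zero)
next
  case (add T S)
  then have "T \<in> bop A" "S \<in> bop A" using alg_gen_bop[OF G] by auto
  then show ?case using alg_gen.add[OF add.IH] by (simp add: cj_add)
next
  case (scale T c)
  then have "T \<in> bop A" using alg_gen_bop[OF G] by auto
  then show ?case using alg_gen.scale[OF scale.IH] by (simp add: cj_scale)
next
  case (mult T S)
  then have "T \<in> bop A" "S \<in> bop A" using alg_gen_bop[OF G] by auto
  then show ?case using alg_gen.mult[OF mult.IH] by (simp only: cj_comp)
qed

text \<open>Conjugation is an isometric homomorphism, so the generators decide. Their images are
  only asked to lie in the generated algebra, because the gauge action turns L_e into a multiple of
  itself.\<close>

lemma cj_norm_closure: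
  assumes G: "Gs \<subseteq> bop A" and cG: "\<And>T. T \<in> Gs \<Longrightarrow> cj T \<in> alg_gen Hs"
    and T: "T \<in> norm_closure A (alg_gen Gs)"
  shows "cj T \<in> norm_closure B (alg_gen Hs)"
  unfolding norm_closure_def
proof (intro CollectI conjI allI impI)
  note b = norm_closure_bop[OF T]
  show "cj T \<in> bop B" using b by (rule cj_bop)
  fix \<epsilon> :: real assume "\<epsilon> > 0"
  then obtain S where S: "S \<in> alg_gen Gs" "opnorm A (op_diff T S) < \<epsilon>"
    by (rule norm_closure_approx[OF T])
  then have "S \<in> bop A" using alg_gen_bop[OF G] by auto
  then have "opnorm B (op_diff (cj T) (cj S)) < \<epsilon>"
    using S b by (metis cj_diff opnorm_cj bop_op_diff)
  then show "\<exists>R\<in>alg_gen Hs. opnorm B (op_diff (cj T) R) < \<epsilon>"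
    using cj_alg_gen[OF G cG S(1)] by blast
qed

end

text \<open>Both maps are contractions and they invert each other, which forces each to be
  isometric.\<close>

lemma wcomp_unitary:
  assumes h: "\<And>w. w \<in> A \<Longrightarrow> h w \<in> B \<and> g (h w) = w"
    and g: "\<And>w. w \<in> B \<Longrightarrow> g w \<in> A \<and> h (g w) = w"
    and c: "\<And>w. w \<in> B \<Longrightarrow> cmod (c w) = 1"
  shows "ell2_unitary A B (wcomp B g c) (wcomp A h (\<lambda>w. inverse (c (h w))))"
proof -
  let ?U = "wcomp B g c" and ?W = "wcomp A h (\<lambda>w. inverse (c (h w)))"
  have ig: "inj_on g B" and ih: "inj_on h A" using g h by (metis inj_onI)+
  have nz: "c w \<noteq> 0" if "w \<in> B" for w using c[OF that] by auto
  have U: "?U x \<in> ell2 B" "norm2 (?U x) \<le> norm2 x" if "x \<in> ell2 A" for x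
    using wcomp_ell2[OF that order_refl ig] c by auto
  have W: "?W y \<in> ell2 A" "norm2 (?W y) \<le> norm2 y" if "y \<in> ell2 B" for y
    using wcomp_ell2[OF that order_refl ih, of "\<lambda>w. inverse (c (h w))"] c h by (auto simp: norm_inverse)
  have WU: "?W (?U x) = x" if "x \<in> ell2 A" for x
    using h nz ell2_outside[OF that] by (auto simp: wcomp_def fun_eq_iff)
  have UW: "?U (?W y) = y" if "y \<in> ell2 B" for y
    using g nz ell2_outside[OF that] by (auto simp: wcomp_def fun_eq_iff)
  have "norm2 (?U x) = norm2 x" if "x \<in> ell2 A" for x
    using U[OF that] W[of "?U x"] WU[OF that] by simp
  then show ?thesis
    by unfold_locales (simp_all only: U W WU UW wcomp_add wcomp_scale)
qed

section \<open>The tensor algebra of a graph\<close>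

locale digraph =
  fixes V :: "'v set" and E :: "'e set" and r s :: "'e \<Rightarrow> 'v"
  assumes countable_digraph: "countable_digraph V E r s"
begin

abbreviation "Pa \<equiv> paths V E r s"
abbreviation "L \<equiv> Lop V E r s"
abbreviation "P \<equiv> Pop V E r s"
abbreviation "Gs \<equiv> L ` E \<union> P ` V"
abbreviation "X \<equiv> tensor_alg V E r s"

lemma r_in_V [simp]: "e \<in> E \<Longrightarrow> r e \<in> V" and s_in_V [simp]: "e \<in> E \<Longrightarrow> s e \<in> V"
  using countable_digraph by (auto simp: countable_digraph_def)

lemma Vx_in_paths [simp]: "Vx v \<in> Pa \<longleftrightarrow> v \<in> V"
  by (auto simp: paths_def)

lemma Px_Cons_in_paths:
  "Px (e # es) \<in> Pa \<longleftrightarrow> e \<in> E \<and> (es = [] \<or> s e = r (hd es) \<and> Px es \<in> Pa)"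
proof (cases es)
  case (Cons f fs)
  have "(\<forall>i. Suc i < length (e # es) \<longrightarrow> s ((e # es) ! i) = r ((e # es) ! Suc i)) \<longleftrightarrow>
    s e = r (hd es) \<and> (\<forall>i. Suc i < length es \<longrightarrow> s (es ! i) = r (es ! Suc i))"
    using Cons by (auto simp: nth_Cons split: nat.splits)
  then show ?thesis using Cons by (auto simp: paths_def image_iff)
qed (auto simp: paths_def)

lemma Px_single_in_paths [simp]: "Px [e] \<in> Pa \<longleftrightarrow> e \<in> E"
  by (simp add: Px_Cons_in_paths)

lemma ptail_Cons: "ptail s (Px (e # es)) = (if es = [] then Vx (s e) else Px es)"
  by (cases es) auto

lemma ptail_in_paths: "Px (e # es) \<in> Pa \<Longrightarrow> ptail s (Px (e # es)) \<in> Pa"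
  by (auto simp: ptail_Cons Px_Cons_in_paths)

lemma prange_ptail: "Px (e # es) \<in> Pa \<Longrightarrow> prange r (ptail s (Px (e # es))) = s e"
  by (auto simp: ptail_Cons Px_Cons_in_paths)

lemma L_bop: "L e \<in> bop Pa"
proof -
  let ?S = "{u \<in> Pa. \<exists>es. u = Px (e # es)}"
  have "L e = (\<lambda>x. if x \<in> ell2 Pa then wcomp ?S (ptail s) (\<lambda>_. 1) x else 0)"
    by (auto simp: Lop_def wcomp_def fun_eq_iff)
  \<comment> \<open>On words beginning with \<open>e\<close> the tail determines the word; the
    one-edge word is told apart by its tail being a vertex.\<close>
  moreover have "inj_on (ptail s) ?S" by (auto simp: inj_on_def ptail_Cons split: if_splits)
  ultimately show ?thesis using wcomp_bop[of ?S Pa "ptail s" "\<lambda>_. 1"] by auto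
qed

lemma P_bop: "P v \<in> bop Pa"
proof -
  let ?S = "{u \<in> Pa. prange r u = v}"
  have "P v = (\<lambda>x. if x \<in> ell2 Pa then wcomp ?S id (\<lambda>_. 1) x else 0)"
    by (auto simp: Pop_def wcomp_def fun_eq_iff)
  then show ?thesis using wcomp_bop[of ?S Pa id "\<lambda>_. 1"] by auto
qed

lemma Gs_bop: "Gs \<subseteq> bop Pa"
  using L_bop P_bop by auto

lemma X_bop: "T \<in> X \<Longrightarrow> T \<in> bop Pa"
  unfolding tensor_alg_def by (rule norm_closure_bop)

lemma alg_gen_X: "T \<in> alg_gen Gs \<Longrightarrow> T \<in> X"
  unfolding tensor_alg_def by (rule norm_closure_base[OF alg_gen_bop[OF Gs_bop]])

lemma L_X: "e \<in> E \<Longrightarrow> L e \<in> X" and P_X: "v \<in> V \<Longrightarrow> P v \<in> X"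
  by (auto intro!: alg_gen_X alg_gen.gen)

lemma zero_X: "(\<lambda>x. 0) \<in> X"
  by (intro alg_gen_X alg_gen.zero)

lemma add_X: "T \<in> X \<Longrightarrow> S \<in> X \<Longrightarrow> op_add T S \<in> X"
  and scale_X: "T \<in> X \<Longrightarrow> op_scale c T \<in> X"
  and comp_X: "T \<in> X \<Longrightarrow> S \<in> X \<Longrightarrow> T \<circ> S \<in> X"
  unfolding tensor_alg_def
  by (rule norm_closure_alg_add[OF Gs_bop] norm_closure_alg_scale[OF Gs_bop]
      norm_closure_alg_comp[OF Gs_bop]; assumption)+

lemma diff_X: "T \<in> X \<Longrightarrow> S \<in> X \<Longrightarrow> op_diff T S \<in> X"
  by (simp add: op_diff_eq add_X scale_X)

lemma X_approx:
  assumes "T \<in> X" "\<epsilon> > 0"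
  obtains S where "S \<in> alg_gen Gs" "opnorm Pa (op_diff T S) < \<epsilon>"
  using assms unfolding tensor_alg_def by (rule norm_closure_approx)

lemma L_apply:
  "x \<in> ell2 Pa \<Longrightarrow> L e x u = (if u \<in> Pa \<and> (\<exists>es. u = Px (e # es)) then x (ptail s u) else 0)"
  by (simp add: Lop_def)

lemma P_apply: "x \<in> ell2 Pa \<Longrightarrow> P v x u = (if u \<in> Pa \<and> prange r u = v then x u else 0)"
  by (simp add: Pop_def)

lemma P_comp_P: "P v \<circ> P v = P v"
  by (rule bop_eqI[OF bop_comp_opnorm(1)[OF P_bop P_bop] P_bop])
    (simp add: P_apply bop_in_ell2[OF P_bop])

lemma P_comp_P_zero: "u \<noteq> v \<Longrightarrow> P u \<circ> P v = (\<lambda>x. 0)"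
  by (rule bop_eqI[OF bop_comp_opnorm(1)[OF P_bop P_bop] bop_op_zero])
    (auto simp: P_apply bop_in_ell2[OF P_bop])

lemma P_comp_L: "P (r e) \<circ> L e = L e"
  by (rule bop_eqI[OF bop_comp_opnorm(1)[OF P_bop L_bop] L_bop])
    (auto simp: P_apply L_apply bop_in_ell2[OF L_bop])

lemma L_comp_P: "L e \<circ> P (s e) = L e"
  by (rule bop_eqI[OF bop_comp_opnorm(1)[OF L_bop P_bop] L_bop])
    (auto simp: P_apply L_apply bop_in_ell2[OF P_bop] ptail_in_paths prange_ptail)

end

section \<open>Characters and point derivations\<close>

context digraph
begin

text \<open>A bounded linear functional on \<open>X\<close>; continuity is required at 0 only, and
  linearity spreads it over \<open>X\<close>.\<close>

definition functional :: "(((('v, 'e) gpath \<Rightarrow> complex) \<Rightarrow> ('v, 'e) gpath \<Rightarrow> complex) \<Rightarrow> complex) \<Rightarrow> bool" where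
  "functional \<rho> \<longleftrightarrow>
     (\<forall>T\<in>X. \<forall>S\<in>X. \<rho> (op_add T S) = \<rho> T + \<rho> S) \<and>
     (\<forall>c. \<forall>T\<in>X. \<rho> (op_scale c T) = c * \<rho> T) \<and>
     (\<forall>\<epsilon>>0. \<exists>\<delta>>0. \<forall>T\<in>X. opnorm Pa T < \<delta> \<longrightarrow> cmod (\<rho> T) < \<epsilon>)"

text \<open>For characters \<rho> and \<sigma> this is the corner entry of a representation by upper
  triangular 2 by 2 matrices with diagonal \<rho>, \<sigma>. Leaving \<rho> and \<sigma> arbitrary
  lets a character count as a derivation against the zero functional.\<close>

definition derivation where
  "derivation \<rho> \<sigma> d \<longleftrightarrow> functional d \<and> (\<forall>T\<in>X. \<forall>S\<in>X. d (T \<circ> S) = \<rho> T * d S + d T * \<sigma> S)"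

definition character where
  "character \<rho> \<longleftrightarrow> functional \<rho> \<and> (\<forall>T\<in>X. \<forall>S\<in>X. \<rho> (T \<circ> S) = \<rho> T * \<rho> S) \<and> (\<exists>T\<in>X. \<rho> T \<noteq> 0)"

lemma
  assumes "functional \<rho>"
  shows functional_add: "T \<in> X \<Longrightarrow> S \<in> X \<Longrightarrow> \<rho> (op_add T S) = \<rho> T + \<rho> S"
    and functional_scale: "T \<in> X \<Longrightarrow> \<rho> (op_scale c T) = c * \<rho> T"
    and functional_cont: "\<epsilon> > 0 \<Longrightarrow> \<exists>\<delta>>0. \<forall>T\<in>X. opnorm Pa T < \<delta> \<longrightarrow> cmod (\<rho> T) < \<epsilon>"
  using assms by (auto simp: functional_def)

lemma functional_zero:
  assumes "functional \<rho>"
  shows "\<rho> (\<lambda>x. 0) = 0"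
  using functional_scale[OF assms zero_X, of 0] by (simp add: op_scale_0)

lemma functional_diff:
  assumes "functional \<rho>" "T \<in> X" "S \<in> X"
  shows "\<rho> (op_diff T S) = \<rho> T - \<rho> S"
  using assms by (simp add: op_diff_eq functional_add functional_scale scale_X)

lemma functional_combine:
  assumes "functional \<rho>" "functional \<sigma>"
  shows "functional (\<lambda>T. \<rho> T + c * \<sigma> T)"
proof -
  have "\<exists>\<delta>>0. \<forall>T\<in>X. opnorm Pa T < \<delta> \<longrightarrow> cmod (\<rho> T + c * \<sigma> T) < \<epsilon>" if e: "\<epsilon> > 0" for \<epsilon> :: real
  proof -
    obtain d1 where d1: "d1 > 0" "\<And>T. T \<in> X \<Longrightarrow> opnorm Pa T < d1 \<Longrightarrow> cmod (\<rho> T) < \<epsilon> / 2"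
      using functional_cont[OF assms(1), of "\<epsilon> / 2"] e by auto
    have c: "0 < cmod c + 1" by (simp add: add_nonneg_pos)
    obtain d2 where d2: "d2 > 0"
      "\<And>T. T \<in> X \<Longrightarrow> opnorm Pa T < d2 \<Longrightarrow> cmod (\<sigma> T) < \<epsilon> / 2 / (cmod c + 1)"
      using functional_cont[OF assms(2), of "\<epsilon> / 2 / (cmod c + 1)"] e c by auto
    have "cmod (\<rho> T + c * \<sigma> T) < \<epsilon>" if T: "T \<in> X" "opnorm Pa T < min d1 d2" for T
    proof -
      have "cmod (c * \<sigma> T) \<le> (cmod c + 1) * cmod (\<sigma> T)"
        by (simp add: norm_mult mult_right_mono)
      also have "\<dots> < \<epsilon> / 2" using d2(2)[of T] T c by (simp add: pos_less_divide_eq algebra_simps)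
      finally have "cmod (c * \<sigma> T) < \<epsilon> / 2" .
      then show ?thesis using d1(2)[of T] T norm_triangle_ineq[of "\<rho> T" "c * \<sigma> T"] by simp
    qed
    then show ?thesis using d1(1) d2(1) by (intro exI[of _ "min d1 d2"]) auto
  qed
  then show ?thesis
    using assms by (auto simp: functional_def algebra_simps)
qed

lemma derivation_combine:
  assumes "derivation \<rho> \<sigma> d" "derivation \<rho> \<sigma> d'"
  shows "derivation \<rho> \<sigma> (\<lambda>T. d T + c * d' T)"
  using assms functional_combine by (auto simp: derivation_def algebra_simps)

lemma derivation_sum:
  assumes "finite F" "\<And>f. f \<in> F \<Longrightarrow> derivation \<rho> \<sigma> (d f)"
  shows "derivation \<rho> \<sigma> (\<lambda>T. \<Sum>f\<in>F. c f * d f T)"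
  using assms
proof (induction F rule: finite_induct)
  case empty
  then show ?case by (auto simp: derivation_def functional_def intro: exI[of _ 1])
next
  case (insert f F)
  then show ?case
    using derivation_combine[of \<rho> \<sigma> "\<lambda>T. \<Sum>f\<in>F. c f * d f T" "d f" "c f"] by (simp add: add.commute)
qed

text \<open>The mixed terms \<rho>(T) \<sigma>(S) cancel. In the matrix picture, this derivation
  arises by conjugating the diagonal representation with a unipotent matrix.\<close>

lemma inner_derivation:
  assumes "character \<rho>" "character \<sigma>"
  shows "derivation \<rho> \<sigma> (\<lambda>T. \<rho> T - \<sigma> T)"
  using assms functional_combine[of \<rho> \<sigma> "-1"]
  by (auto simp: derivation_def character_def algebra_simps)

lemma functional_eq_0_X:
  assumes \<rho>: "functional \<rho>" and 0: "\<And>T. T \<in> alg_gen Gs \<Longrightarrow> \<rho> T = 0" and T: "T \<in> X"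
  shows "\<rho> T = 0"
proof (rule ccontr)
  assume "\<rho> T \<noteq> 0"
  then obtain \<delta> where d: "\<delta> > 0" "\<And>S. S \<in> X \<Longrightarrow> opnorm Pa S < \<delta> \<Longrightarrow> cmod (\<rho> S) < cmod (\<rho> T)"
    using functional_cont[OF \<rho>, of "cmod (\<rho> T)"] by auto
  obtain S where S: "S \<in> alg_gen Gs" "opnorm Pa (op_diff T S) < \<delta>" using X_approx[OF T d(1)] .
  then have "cmod (\<rho> T - \<rho> S) < cmod (\<rho> T)"
    using d(2)[OF diff_X[OF T alg_gen_X[OF S(1)]]] functional_diff[OF \<rho> T alg_gen_X[OF S(1)]] by simp
  then show False using 0[OF S(1)] by simp
qed

text \<open>The Leibniz rule carries the vanishing from the generators to all products, and
  continuity carries it to norm limits.\<close>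

lemma derivation_eq_0:
  assumes d: "derivation \<rho> \<sigma> d"
    and "\<And>v. v \<in> V \<Longrightarrow> d (P v) = 0" "\<And>e. e \<in> E \<Longrightarrow> d (L e) = 0" and "T \<in> X"
  shows "d T = 0"
proof (rule functional_eq_0_X[OF _ _ \<open>T \<in> X\<close>])
  show f: "functional d" using d by (simp add: derivation_def)
  fix T assume "T \<in> alg_gen Gs"
  then show "d T = 0"
  proof induction
    case (gen T)
    then show ?case using assms by auto
  next
    case zero
    show ?case by (rule functional_zero[OF f])
  next
    case (add T S)
    then show ?case using functional_add[OF f] alg_gen_X by auto
  next
    case (scale T c)
    then show ?case using functional_scale[OF f] alg_gen_X by auto
  next
    case (mult T S)
    have "d (T \<circ> S) = \<rho> T * d S + d T * \<sigma> S"
      using d alg_gen_X mult.hyps unfolding derivation_def by blast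
    then show ?case by (simp only: mult.IH mult_zero_left mult_zero_right add_0)
  qed
qed

section \<open>Characters, their vertices, and the derivations between them\<close>

lemma
  assumes "character \<rho>"
  shows character_functional: "functional \<rho>"
    and character_mult: "T \<in> X \<Longrightarrow> S \<in> X \<Longrightarrow> \<rho> (T \<circ> S) = \<rho> T * \<rho> S"
    and character_nonzero: "\<exists>T\<in>X. \<rho> T \<noteq> 0"
  using assms by (auto simp: character_def)

lemma character_idempotent:
  assumes "character \<rho>" "p \<in> X" "p \<circ> p = p"
  shows "\<rho> p = 0 \<or> \<rho> p = 1"
  using character_mult[OF assms(1,2,2)] assms(3) by (metis mult_cancel_left1)

lemma character_P:
  assumes "character \<rho>" "\<rho> (P v) = 1" "v \<in> V" "u \<in> V"
  shows "\<rho> (P u) = (if u = v then 1 else 0)"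
  using assms functional_zero[OF character_functional[OF assms(1)]]
    character_mult[OF assms(1) P_X[OF assms(4)] P_X[OF assms(3)]] P_comp_P_zero[of u v] by auto

lemma character_vertex:
  assumes \<rho>: "character \<rho>"
  shows "\<exists>!v. v \<in> V \<and> \<rho> (P v) = 1"
proof -
  have "\<exists>v\<in>V. \<rho> (P v) \<noteq> 0"
  proof (rule ccontr)
    assume "\<not> (\<exists>v\<in>V. \<rho> (P v) \<noteq> 0)"
    then have P0: "\<rho> (P v) = 0" if "v \<in> V" for v using that by auto
    \<comment> \<open>With 0 as second functional, multiplicativity of \<rho> is a Leibniz rule, so
      vanishing on the generators makes \<rho> vanish on \<open>X\<close>. The L_e are covered
      because L_e = P_{r e} L_e.\<close>
    have d: "derivation \<rho> (\<lambda>T. 0) \<rho>"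
      using \<rho> by (simp add: derivation_def character_def)
    have "\<rho> (L e) = 0" if "e \<in> E" for e
      using character_mult[OF \<rho> P_X[OF r_in_V] L_X, OF that that] P0[OF r_in_V[OF that]] P_comp_L[of e]
      by simp
    then have "\<rho> T = 0" if "T \<in> X" for T using derivation_eq_0[OF d P0 _ that] by auto
    then show False using character_nonzero[OF \<rho>] by auto
  qed
  then obtain v where v: "v \<in> V" "\<rho> (P v) = 1"
    using character_idempotent[OF \<rho> P_X P_comp_P] by auto
  then show ?thesis using character_P[OF \<rho> v(2,1)] by (metis zero_neq_one)
qed

text \<open>The upper bound on derivations: modulo multiples of \<rho> - \<sigma>, a derivation is
  determined by its values on the edges from \<open>v\<close> to \<open>w\<close>. Every other
  generator is killed by the Leibniz rule applied to the relations among the P_u and L_e.\<close>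

lemma derivation_inner:
  assumes \<rho>: "character \<rho>" "\<rho> (P w) = 1" "w \<in> V" and \<sigma>: "character \<sigma>" "\<sigma> (P v) = 1" "v \<in> V"
    and d: "derivation \<rho> \<sigma> d"
    and edges: "\<And>e. e \<in> E \<Longrightarrow> r e = w \<Longrightarrow> s e = v \<Longrightarrow> d (L e) = 0"
  shows "\<exists>c. (v = w \<longrightarrow> c = 0) \<and> (\<forall>T\<in>X. d T = c * (\<rho> T - \<sigma> T))"
proof -
  define c where "c = d (P w)"
  note \<rho>P = character_P[OF \<rho>] and \<sigma>P = character_P[OF \<sigma>]
  have dm: "d (T \<circ> S) = \<rho> T * d S + d T * \<sigma> S" if "T \<in> X" "S \<in> X" for T S
    using d that unfolding derivation_def by blast
  \<comment> \<open>The Leibniz rule for P_w P_w = P_w reads c = 2c.\<close>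
  have c0: "c = 0" if "v = w"
    using dm[OF P_X P_X, OF \<rho>(3) \<rho>(3)] that \<rho>P \<sigma>P \<rho>(3) by (simp add: P_comp_P c_def)
  \<comment> \<open>If \<open>v\<close> and \<open>w\<close> differ, then \<rho> - \<sigma> is 1 on
    \<open>P w\<close>, so this multiple is the one that makes \<open>D\<close> vanish there;
    otherwise \<open>c\<close> is already 0.\<close>
  define D where "D = (\<lambda>T. d T + (- c) * (\<rho> T - \<sigma> T))"
  have D: "derivation \<rho> \<sigma> D"
    unfolding D_def by (intro derivation_combine d inner_derivation \<rho> \<sigma>)
  then have f: "functional D" by (simp add: derivation_def)
  have Dm: "D (T \<circ> S) = \<rho> T * D S + D T * \<sigma> S" if "T \<in> X" "S \<in> X" for T S
    using D that unfolding derivation_def by blast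
  have Dw: "D (P w) = 0" using c0 \<rho>P \<sigma>P \<rho>(3) by (auto simp: D_def c_def[symmetric])
  have DP: "D (P u) = 0" if u: "u \<in> V" for u
  proof (cases "u = w")
    case False
    show ?thesis
    proof (cases "u = v")
      case True
      have "D (P w \<circ> P v) = 0" using functional_zero[OF f] P_comp_P_zero[of w v] False True by simp
      then show ?thesis using Dm[OF P_X P_X, OF \<rho>(3) \<sigma>(3)] \<rho>P \<sigma>P \<rho>(3) \<sigma>(3) Dw True by simp
    next
      case u': False
      then show ?thesis using Dm[OF P_X P_X, OF u u] \<rho>P[OF u] \<sigma>P[OF u] False by (simp add: P_comp_P)
    qed
  qed (use Dw in simp)
  \<comment> \<open>Between distinct vertices both characters vanish on L_e, so the correction
    leaves the edge values of \<open>d\<close> intact. On loops they may be nonzero, but there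
    \<open>c = 0\<close>.\<close>
  have \<rho>L: "\<rho> (L e) = 0" if "e \<in> E" "r e = w" "s e = v" "v \<noteq> w" for e
    using character_mult[OF \<rho>(1) L_X P_X, OF that(1) \<sigma>(3)] L_comp_P[of e] \<rho>P[OF \<sigma>(3)] that by simp
  have \<sigma>L: "\<sigma> (L e) = 0" if "e \<in> E" "r e = w" "s e = v" "v \<noteq> w" for e
    using character_mult[OF \<sigma>(1) P_X L_X, OF \<rho>(3) that(1)] P_comp_L[of e] \<sigma>P[OF \<rho>(3)] that by simp
  have DL: "D (L e) = 0" if e: "e \<in> E" for e
  proof (cases "r e = w \<and> s e = v")
    case True
    then show ?thesis using edges[OF e] \<rho>L[OF e] \<sigma>L[OF e] c0 by (cases "v = w") (auto simp: D_def)
  next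
    case False
    have 1: "D (L e) = \<rho> (P (r e)) * D (L e)"
      using Dm[OF P_X L_X, OF r_in_V e, OF e] P_comp_L[of e] DP[OF r_in_V[OF e]] by simp
    have 2: "D (L e) = D (L e) * \<sigma> (P (s e))"
      using Dm[OF L_X P_X, OF e s_in_V, OF e] L_comp_P[of e] DP[OF s_in_V[OF e]] by simp
    show ?thesis using 1 2 \<rho>P[OF r_in_V[OF e]] \<sigma>P[OF s_in_V[OF e]] False by (auto split: if_splits)
  qed
  have "D T = 0" if "T \<in> X" for T by (rule derivation_eq_0[OF D DP DL that])
  then show ?thesis using c0 unfolding D_def by (intro exI[of _ c]) (auto simp: algebra_simps)
qed

subsection \<open>Vacuum characters and edge derivations\<close>

definition vac :: "'v \<Rightarrow> ((('v, 'e) gpath \<Rightarrow> complex) \<Rightarrow> ('v, 'e) gpath \<Rightarrow> complex) \<Rightarrow> complex" where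
  "vac v T = T (ket (Vx v)) (Vx v)"
definition edge :: "'e \<Rightarrow> ((('v, 'e) gpath \<Rightarrow> complex) \<Rightarrow> ('v, 'e) gpath \<Rightarrow> complex) \<Rightarrow> complex" where
  "edge f T = T (ket (Vx (s f))) (Px [f])"

text \<open>A density argument for expressions that are Lipschitz on all bounded operators, with no
  linearity to check. It extends the matrix identities below from the generated algebra to its norm
  closure.\<close>

lemma X_limit:
  assumes lip: "\<And>T S. T \<in> bop Pa \<Longrightarrow> S \<in> bop Pa \<Longrightarrow> cmod (g T - g S) \<le> C * opnorm Pa (op_diff T S)"
    and 0: "\<And>T. T \<in> alg_gen Gs \<Longrightarrow> g T = 0" and T: "T \<in> X"
  shows "g T = (0::complex)"
proof (rule ccontr)
  assume n: "g T \<noteq> 0"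
  have C: "0 < \<bar>C\<bar> + 1" by simp
  then have "cmod (g T) / (\<bar>C\<bar> + 1) > 0" using n by simp
  from X_approx[OF T this] obtain S
    where S: "S \<in> alg_gen Gs" "opnorm Pa (op_diff T S) < cmod (g T) / (\<bar>C\<bar> + 1)" by blast
  have b: "T \<in> bop Pa" "S \<in> bop Pa" using T S(1) X_bop alg_gen_X by auto
  have "cmod (g T) \<le> C * opnorm Pa (op_diff T S)" using lip[OF b] 0[OF S(1)] by simp
  also have "\<dots> \<le> (\<bar>C\<bar> + 1) * opnorm Pa (op_diff T S)"
    using opnorm_nonneg[OF bop_op_diff[OF b]] by (intro mult_right_mono) auto
  also have "\<dots> < cmod (g T)" using S(2) C by (simp add: pos_less_divide_eq mult.commute)
  finally show False by simp
qed

lemma vac_diff_le: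
  assumes "T \<in> bop Pa" "S \<in> bop Pa" "v \<in> V"
  shows "cmod (vac v T - vac v S) \<le> opnorm Pa (op_diff T S)"
  using cmod_diff_le_opnorm[OF assms(1,2) ket_ell2[of "Vx v"], of "Vx v"] assms(3)
  by (simp add: vac_def norm2_ket)

lemma edge_diff_le:
  assumes "T \<in> bop Pa" "S \<in> bop Pa" "f \<in> E"
  shows "cmod (edge f T - edge f S) \<le> opnorm Pa (op_diff T S)"
  using cmod_diff_le_opnorm[OF assms(1,2) ket_ell2[of "Vx (s f)"], of "Px [f]"] assms(3)
  by (simp add: edge_def norm2_ket)

lemma vac_P: "v \<in> V \<Longrightarrow> vac v (P u) = (if u = v then 1 else 0)"
  by (auto simp: vac_def P_apply ket_ell2) (simp add: ket_def)

lemma vac_L: "v \<in> V \<Longrightarrow> vac v (L e) = 0"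
  by (auto simp: vac_def L_apply ket_ell2)

lemma edge_P: "f \<in> E \<Longrightarrow> edge f (P u) = 0"
  by (auto simp: edge_def P_apply ket_ell2) (simp add: ket_def)

lemma edge_L: "f \<in> E \<Longrightarrow> edge f (L e) = (if e = f then 1 else 0)"
  by (auto simp: edge_def L_apply ket_ell2) (simp add: ket_def)

text \<open>Creation operators lengthen paths and vertices are the shortest ones, so in the matrix
  of \<open>T\<close> the row of a vertex has only its diagonal entry. Multiplicativity of
  \<open>vac\<close> follows.\<close>

lemma vac_eval_alg:
  assumes v: "v \<in> V" and "T \<in> alg_gen Gs"
  shows "\<forall>x\<in>ell2 Pa. T x (Vx v) = vac v T * x (Vx v)"
proof -
  \<comment> \<open>An unspecified coefficient is what the induction can carry; evaluation at
    \<open>ket (Vx v)\<close> identifies it afterwards.\<close>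
  have "\<exists>t. \<forall>x\<in>ell2 Pa. T x (Vx v) = t * x (Vx v)"
    using assms(2)
  proof induction
    case (gen T)
    then show ?case
    proof
      assume "T \<in> L ` E"
      then show ?thesis by (intro exI[of _ 0]) (auto simp: L_apply)
    next
      assume "T \<in> P ` V"
      then obtain u where "T = P u" by auto
      then show ?thesis using v by (intro exI[of _ "if u = v then 1 else 0"]) (auto simp: P_apply)
    qed
  next
    case zero
    show ?case by (intro exI[of _ 0]) simp
  next
    case (add T S)
    then obtain t u where "\<forall>x\<in>ell2 Pa. T x (Vx v) = t * x (Vx v)" "\<forall>x\<in>ell2 Pa. S x (Vx v) = u * x (Vx v)"
      by blast
    then show ?case by (intro exI[of _ "t + u"]) (simp add: op_add_def algebra_simps)
  next
    case (scale T c)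
    then obtain t where "\<forall>x\<in>ell2 Pa. T x (Vx v) = t * x (Vx v)" by blast
    then show ?case by (intro exI[of _ "c * t"]) (simp add: op_scale_def)
  next
    case (mult T S)
    then obtain t u where "\<forall>x\<in>ell2 Pa. T x (Vx v) = t * x (Vx v)" "\<forall>x\<in>ell2 Pa. S x (Vx v) = u * x (Vx v)"
      by blast
    moreover have "S \<in> bop Pa" using mult.hyps alg_gen_X X_bop by blast
    ultimately show ?case by (intro exI[of _ "t * u"]) (simp add: bop_in_ell2)
  qed
  then obtain t where t: "\<forall>x\<in>ell2 Pa. T x (Vx v) = t * x (Vx v)" by blast
  then have "vac v T = t" using v ket_ell2[of "Vx v" Pa] by (simp add: vac_def ket_def)
  then show ?thesis using t by simp
qed

lemma vac_eval:
  assumes v: "v \<in> V" and T: "T \<in> X" and x: "x \<in> ell2 Pa"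
  shows "T x (Vx v) = vac v T * x (Vx v)"
proof -
  have "T x (Vx v) - vac v T * x (Vx v) = 0"
  proof (rule X_limit[OF _ _ T])
    fix T S assume b: "T \<in> bop Pa" "S \<in> bop Pa"
    let ?n = "opnorm Pa (op_diff T S)"
    have "cmod ((T x (Vx v) - vac v T * x (Vx v)) - (S x (Vx v) - vac v S * x (Vx v)))
      = cmod ((T x (Vx v) - S x (Vx v)) - (vac v T - vac v S) * x (Vx v))"
      by (simp add: algebra_simps)
    also have "\<dots> \<le> cmod (T x (Vx v) - S x (Vx v)) + cmod (vac v T - vac v S) * cmod (x (Vx v))"
      by (metis norm_triangle_ineq4 norm_mult)
    also have "\<dots> \<le> ?n * norm2 x + ?n * norm2 x"
      using b x v by (intro add_mono mult_mono cmod_diff_le_opnorm vac_diff_le cmod_le_norm2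
          opnorm_nonneg bop_op_diff) auto
    finally show "cmod ((T x (Vx v) - vac v T * x (Vx v)) - (S x (Vx v) - vac v S * x (Vx v)))
      \<le> (2 * norm2 x) * ?n" by simp
  qed (use vac_eval_alg[OF v] x in auto)
  then show ?thesis by simp
qed

lemma vac_mult:
  assumes "v \<in> V" "T \<in> X" "S \<in> X"
  shows "vac v (T \<circ> S) = vac v T * vac v S"
  using vac_eval[OF assms(1,2) bop_in_ell2[OF X_bop[OF assms(3)]], of "ket (Vx v)"]
  by (simp add: vac_def)

text \<open>The row of an edge has at most two nonzero entries, at the edge and at its source. The
  diagonal one equals that of the vertex \<open>r f\<close>, since P_v looks at the range only.
  Multiplying such rows gives the Leibniz rule for \<open>edge f\<close>.\<close>

lemma edge_eval_alg:
  assumes f: "f \<in> E" and "T \<in> alg_gen Gs"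
  shows "\<forall>x\<in>ell2 Pa. T x (Px [f]) = vac (r f) T * x (Px [f]) + edge f T * x (Vx (s f))"
proof -
  have "\<exists>t. \<forall>x\<in>ell2 Pa. T x (Px [f]) = vac (r f) T * x (Px [f]) + t * x (Vx (s f))"
    using assms(2)
  proof induction
    case (gen T)
    then show ?case
    proof
      assume "T \<in> L ` E"
      then obtain e where "T = L e" by auto
      then show ?thesis using f
        by (intro exI[of _ "if e = f then 1 else 0"]) (auto simp: L_apply vac_L)
    next
      assume "T \<in> P ` V"
      then obtain u where "T = P u" by auto
      then show ?thesis using f by (intro exI[of _ 0]) (auto simp: P_apply vac_P)
    qed
  next
    case zero
    show ?case by (intro exI[of _ 0]) (simp add: vac_def)
  next
    case (add T S)
    then obtain t u where "\<forall>x\<in>ell2 Pa. T x (Px [f]) = vac (r f) T * x (Px [f]) + t * x (Vx (s f))"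
      "\<forall>x\<in>ell2 Pa. S x (Px [f]) = vac (r f) S * x (Px [f]) + u * x (Vx (s f))"
      by blast
    then show ?case by (intro exI[of _ "t + u"]) (simp add: op_add_def vac_def algebra_simps)
  next
    case (scale T c)
    then obtain t where "\<forall>x\<in>ell2 Pa. T x (Px [f]) = vac (r f) T * x (Px [f]) + t * x (Vx (s f))" by blast
    then show ?case by (intro exI[of _ "c * t"]) (simp add: op_scale_def vac_def algebra_simps)
  next
    case (mult T S)
    then obtain t u where tu: "\<forall>x\<in>ell2 Pa. T x (Px [f]) = vac (r f) T * x (Px [f]) + t * x (Vx (s f))"
      "\<forall>x\<in>ell2 Pa. S x (Px [f]) = vac (r f) S * x (Px [f]) + u * x (Vx (s f))"
      by blast
    have X: "T \<in> X" "S \<in> X" using mult.hyps alg_gen_X by auto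
    show ?case
      \<comment> \<open>The entry of the matrix product at row \<open>f\<close> and column
        \<open>s f\<close>.\<close>
      by (intro exI[of _ "vac (r f) T * u + t * vac (s f) S"])
        (simp add: vac_mult[OF r_in_V[OF f] X, unfolded comp_def] tu bop_in_ell2[OF X_bop[OF X(2)]]
          vac_eval[OF s_in_V[OF f] X(2)] algebra_simps)
  qed
  then obtain t where t: "\<forall>x\<in>ell2 Pa. T x (Px [f]) = vac (r f) T * x (Px [f]) + t * x (Vx (s f))" by blast
  then have "edge f T = t" using f ket_ell2[of "Vx (s f)" Pa] by (simp add: edge_def) (simp add: ket_def)
  then show ?thesis using t by simp
qed

lemma edge_eval:
  assumes f: "f \<in> E" and T: "T \<in> X" and x: "x \<in> ell2 Pa"
  shows "T x (Px [f]) = vac (r f) T * x (Px [f]) + edge f T * x (Vx (s f))"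
proof -
  let ?g = "\<lambda>T. T x (Px [f]) - vac (r f) T * x (Px [f]) - edge f T * x (Vx (s f))"
  have "?g T = 0"
  proof (rule X_limit[OF _ _ T])
    fix T S assume b: "T \<in> bop Pa" "S \<in> bop Pa"
    let ?n = "opnorm Pa (op_diff T S)"
    have "cmod (?g T - ?g S) = cmod ((T x (Px [f]) - S x (Px [f]))
        - (vac (r f) T - vac (r f) S) * x (Px [f]) - (edge f T - edge f S) * x (Vx (s f)))"
      by (simp add: algebra_simps)
    also have "\<dots> \<le> cmod (T x (Px [f]) - S x (Px [f]))
        + cmod (vac (r f) T - vac (r f) S) * cmod (x (Px [f]))
        + cmod (edge f T - edge f S) * cmod (x (Vx (s f)))"
      unfolding norm_mult[symmetric] by (intro order_trans[OF norm_triangle_ineq4] add_mono order_refl)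
    also have "\<dots> \<le> ?n * norm2 x + ?n * norm2 x + ?n * norm2 x"
      using b x f by (intro add_mono mult_mono cmod_diff_le_opnorm vac_diff_le edge_diff_le cmod_le_norm2
          opnorm_nonneg bop_op_diff r_in_V) auto
    finally show "cmod (?g T - ?g S) \<le> (3 * norm2 x) * ?n" by simp
  next
    fix T assume "T \<in> alg_gen Gs"
    from edge_eval_alg[OF f this] x show "?g T = 0" by simp
  qed
  then show ?thesis by (simp add: algebra_simps)
qed

lemma lipschitz_functional:
  assumes "\<And>T S. T \<in> X \<Longrightarrow> S \<in> X \<Longrightarrow> \<rho> (op_add T S) = \<rho> T + \<rho> S"
    and "\<And>c T. T \<in> X \<Longrightarrow> \<rho> (op_scale c T) = c * \<rho> T"
    and lip: "\<And>T S. T \<in> bop Pa \<Longrightarrow> S \<in> bop Pa \<Longrightarrow> cmod (\<rho> T - \<rho> S) \<le> opnorm Pa (op_diff T S)"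
  shows "functional \<rho>"
proof -
  have 0: "\<rho> (\<lambda>x. 0) = 0"
    using assms(2)[OF zero_X, of 0] by (simp add: op_scale_0)
  have "cmod (\<rho> T) \<le> opnorm Pa T" if "T \<in> X" for T
    using lip[OF X_bop[OF that] bop_op_zero] 0 by (simp add: op_diff_def)
  then show ?thesis
    using assms(1,2) unfolding functional_def by (meson order_le_less_trans)
qed

lemma vac_character:
  assumes v: "v \<in> V"
  shows "character (vac v)"
  unfolding character_def
proof (intro conjI ballI)
  show "functional (vac v)"
    by (rule lipschitz_functional) (use v in \<open>auto simp: vac_diff_le\<close>, auto simp: vac_def op_add_def op_scale_def)
  show "\<exists>T\<in>X. vac v T \<noteq> 0" using v by (intro bexI[of _ "P v"]) (auto simp: vac_P P_X)
qed (rule vac_mult[OF v])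

lemma edge_derivation:
  assumes f: "f \<in> E"
  shows "derivation (vac (r f)) (vac (s f)) (edge f)"
  unfolding derivation_def
proof (intro conjI ballI)
  show "functional (edge f)"
    by (rule lipschitz_functional) (use f in \<open>auto simp: edge_diff_le\<close>, auto simp: edge_def op_add_def op_scale_def)
  fix T S assume X: "T \<in> X" "S \<in> X"
  let ?x = "ket (Vx (s f))"
  have x: "?x \<in> ell2 Pa" using f by (simp add: ket_ell2)
  show "edge f (T \<circ> S) = vac (r f) T * edge f S + edge f T * vac (s f) S"
    using edge_eval[OF f X(1) bop_in_ell2[OF X_bop[OF X(2)]], of ?x]
    by (simp add: edge_def vac_def)
qed

end

subsection \<open>Gauge action\<close>

primrec plen :: "('v, 'e) gpath \<Rightarrow> nat" where
  "plen (Vx v) = 0"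
| "plen (Px es) = length es"

context digraph
begin

text \<open>Conjugation by the diagonal operator that multiplies \<xi>_u by z^|u|; it is unitary,
  and used, for |z| = 1.\<close>

definition gauge where
  "gauge z = unitary_conj Pa (wcomp Pa id (\<lambda>u. z ^ plen u)) (wcomp Pa id (\<lambda>u. inverse (z ^ plen u)))"

lemma gauge_unitary:
  assumes "cmod z = 1"
  shows "ell2_unitary Pa Pa (wcomp Pa id (\<lambda>u. z ^ plen u)) (wcomp Pa id (\<lambda>u. inverse (z ^ plen u)))"
  using wcomp_unitary[of Pa id Pa id "\<lambda>u. z ^ plen u"] assms by (simp add: norm_power)

lemma gauge_P:
  assumes z: "cmod z = 1"
  shows "gauge z (P v) = P v"
proof -
  interpret U: ell2_unitary Pa Pa "wcomp Pa id (\<lambda>u. z ^ plen u)" "wcomp Pa id (\<lambda>u. inverse (z ^ plen u))"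
    by (rule gauge_unitary[OF z])
  have "z \<noteq> 0" using z by auto
  then show ?thesis unfolding gauge_def
    by (intro bop_eqI[OF U.cj_bop[OF P_bop] P_bop])
      (auto simp: unitary_conj_def wcomp_def P_apply U.W_ell2[unfolded wcomp_def])
qed

lemma gauge_L:
  assumes z: "cmod z = 1"
  shows "gauge z (L e) = op_scale z (L e)"
proof -
  interpret U: ell2_unitary Pa Pa "wcomp Pa id (\<lambda>u. z ^ plen u)" "wcomp Pa id (\<lambda>u. inverse (z ^ plen u))"
    by (rule gauge_unitary[OF z])
  have z0: "z \<noteq> 0" using z by auto
  have plen: "plen (ptail s (Px (e # es))) = length es" for es by (auto simp: ptail_Cons)
  show ?thesis unfolding gauge_def
  proof (rule bop_eqI[OF U.cj_bop[OF L_bop] bop_op_scale_opnorm(1)[OF L_bop]])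
    fix x u assume x: "x \<in> ell2 Pa"
    show "U.cj (L e) x u = op_scale z (L e) x u"
      using z0 plen ptail_in_paths x
      by (auto simp: unitary_conj_def op_scale_def wcomp_def L_apply U.W_ell2[OF x, unfolded wcomp_def])
  qed
qed

lemma gauge_hom:
  assumes z: "cmod z = 1" and X: "T \<in> X" "S \<in> X"
  shows "gauge z (op_add T S) = op_add (gauge z T) (gauge z S)"
    "gauge z (op_diff T S) = op_diff (gauge z T) (gauge z S)"
    "gauge z (op_scale c T) = op_scale c (gauge z T)"
    "gauge z (T \<circ> S) = gauge z T \<circ> gauge z S"
    "opnorm Pa (gauge z T) = opnorm Pa T"
  using ell2_unitary.cj_add[OF gauge_unitary[OF z]] ell2_unitary.cj_diff[OF gauge_unitary[OF z]]
    ell2_unitary.cj_scale[OF gauge_unitary[OF z]] ell2_unitary.cj_comp[OF gauge_unitary[OF z]]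
    ell2_unitary.opnorm_cj[OF gauge_unitary[OF z]] X[THEN X_bop]
  unfolding gauge_def by blast+

lemma gauge_zero: "cmod z = 1 \<Longrightarrow> gauge z (\<lambda>x. 0) = (\<lambda>x. 0)"
  unfolding gauge_def by (rule ell2_unitary.cj_zero[OF gauge_unitary])

lemma gauge_X:
  assumes z: "cmod z = 1" and T: "T \<in> X"
  shows "gauge z T \<in> X"
proof -
  have "gauge z T \<in> alg_gen Gs" if "T \<in> Gs" for T
    using that
  proof
    assume "T \<in> L ` E"
    then show ?thesis using gauge_L[OF z] by (auto intro!: alg_gen.scale[OF alg_gen.gen])
  next
    assume "T \<in> P ` V"
    then show ?thesis using gauge_P[OF z] by (auto intro: alg_gen.gen)
  qed
  then show ?thesis
    using ell2_unitary.cj_norm_closure[OF gauge_unitary[OF z] Gs_bop, of Gs T] T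
    unfolding gauge_def tensor_alg_def by blast
qed

text \<open>Each factor L_e contributes one power of \<open>z\<close>, so the constant term comes
  from the part of \<open>T\<close> without edges, on which \<rho> and \<open>vac v\<close> agree.
  The polynomial extends the gauge orbit from the circle to the disc and joins \<rho>(T) at
  \<open>z = 1\<close> to \<open>vac v T\<close> at \<open>z = 0\<close>.\<close>

lemma character_gauge_poly:
  assumes \<rho>: "character \<rho>" "\<rho> (P v) = 1" "v \<in> V" and "T \<in> alg_gen Gs"
  shows "\<exists>f. (\<forall>z. cmod z = 1 \<longrightarrow> \<rho> (gauge z T) = poly f z) \<and> poly f 0 = vac v T"
  using assms(4)
proof induction
  case (gen T)
  then show ?case
  proof
    assume "T \<in> L ` E"
    then obtain e where e: "e \<in> E" "T = L e" by auto
    then show ?thesis using \<rho>(3) functional_scale[OF character_functional[OF \<rho>(1)] L_X]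
      by (intro exI[of _ "[:0, \<rho> (L e):]"]) (auto simp: gauge_L vac_L)
  next
    assume "T \<in> P ` V"
    then obtain u where "u \<in> V" "T = P u" by auto
    then show ?thesis using \<rho>(3) character_P[OF \<rho>]
      by (intro exI[of _ "[:if u = v then 1 else 0:]"]) (auto simp: gauge_P vac_P)
  qed
next
  case zero
  show ?case using functional_zero[OF character_functional[OF \<rho>(1)]]
    functional_zero[OF character_functional[OF vac_character[OF \<rho>(3)]]]
    by (intro exI[of _ 0] conjI allI impI, subst gauge_zero) (simp_all only: poly_0)
next
  case (add T S)
  then obtain f g where "\<forall>z. cmod z = 1 \<longrightarrow> \<rho> (gauge z T) = poly f z" "poly f 0 = vac v T"
    "\<forall>z. cmod z = 1 \<longrightarrow> \<rho> (gauge z S) = poly g z" "poly g 0 = vac v S" by blast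
  moreover have "T \<in> X" "S \<in> X" using add.hyps alg_gen_X by auto
  ultimately show ?case
    using functional_add[OF character_functional[OF \<rho>(1)]]
      functional_add[OF character_functional[OF vac_character[OF \<rho>(3)]]]
    by (intro exI[of _ "f + g"]) (auto simp: gauge_hom gauge_X)
next
  case (scale T c)
  then obtain f where "\<forall>z. cmod z = 1 \<longrightarrow> \<rho> (gauge z T) = poly f z" "poly f 0 = vac v T" by blast
  moreover have "T \<in> X" using scale.hyps alg_gen_X by auto
  ultimately show ?case
    using functional_scale[OF character_functional[OF \<rho>(1)]]
      functional_scale[OF character_functional[OF vac_character[OF \<rho>(3)]]]
    by (intro exI[of _ "smult c f"]) (auto simp: gauge_hom gauge_X)
next
  case (mult T S)
  then obtain f g where fg: "\<forall>z. cmod z = 1 \<longrightarrow> \<rho> (gauge z T) = poly f z" "poly f 0 = vac v T"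
    "\<forall>z. cmod z = 1 \<longrightarrow> \<rho> (gauge z S) = poly g z" "poly g 0 = vac v S" by blast
  have X: "T \<in> X" "S \<in> X" using mult.hyps alg_gen_X by auto
  have "\<rho> (gauge z (T \<circ> S)) = poly (f * g) z" if z: "cmod z = 1" for z
    using fg z by (simp only: gauge_hom(4)[OF z X] character_mult[OF \<rho>(1) gauge_X[OF z X(1)] gauge_X[OF z X(2)]] poly_mult)
  moreover have "poly (f * g) 0 = vac v (T \<circ> S)"
    using fg by (simp only: vac_mult[OF \<rho>(3) X] poly_mult)
  ultimately show ?case by blast
qed

text \<open>On the circle \<open>z \<mapsto> \<rho> (\<gamma>\<^sub>z p)\<close> takes the values 0 and 1 only, and it is a uniform limit of
  polynomials whose constant terms tend to \<open>vac v p\<close>. Hence it is constant, and by the maximum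
  principle the constant is \<open>vac v p\<close>.\<close>

lemma character_idempotent_eq_vac:
  assumes \<rho>: "character \<rho>" "\<rho> (P v) = 1" "v \<in> V" and p: "p \<in> X" "p \<circ> p = p"
  shows "\<rho> p = vac v p"
proof -
  note fr = character_functional[OF \<rho>(1)]
  \<comment> \<open>With errors of 1/4 the discs around 0 and 1 stay disjoint, and the two errors
    met at the end add up to less than 1, the distance between the possible values of \<rho>(p) and
    \<open>vac v p\<close>.\<close>
  obtain \<delta> where d: "\<delta> > 0" "\<And>T. T \<in> X \<Longrightarrow> opnorm Pa T < \<delta> \<Longrightarrow> cmod (\<rho> T) < 1 / 4"
    using functional_cont[OF fr, of "1 / 4"] by auto
  have "min \<delta> (1 / 4) > 0" using d by simp
  from X_approx[OF p(1) this] obtain q where q: "q \<in> alg_gen Gs" "opnorm Pa (op_diff p q) < \<delta>"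
    "opnorm Pa (op_diff p q) < 1 / 4" by auto
  note qX = alg_gen_X[OF q(1)]
  obtain f where f: "\<And>z. cmod z = 1 \<Longrightarrow> \<rho> (gauge z q) = poly f z" "poly f 0 = vac v q"
    using character_gauge_poly[OF \<rho> q(1)] by blast
  have f0: "cmod (vac v p - poly f 0) < 1 / 4"
    using vac_diff_le[OF X_bop[OF p(1)] X_bop[OF qX] \<rho>(3)] q(3) f(2) by simp
  have fz: "cmod (\<rho> (gauge z p) - poly f z) < 1 / 4" if z: "cmod z = 1" for z
  proof -
    have "cmod (\<rho> (gauge z (op_diff p q))) < 1 / 4"
      by (rule d(2)) (use z p qX q(2) in \<open>auto simp: gauge_X diff_X gauge_hom(5)\<close>)
    then show ?thesis
      using gauge_hom(2)[OF z p(1) qX] functional_diff[OF fr gauge_X[OF z p(1)] gauge_X[OF z qX]] f(1)[OF z]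
      by simp
  qed
  have id: "\<rho> (gauge z p) = 0 \<or> \<rho> (gauge z p) = 1" if z: "cmod z = 1" for z
    using character_idempotent[OF \<rho>(1) gauge_X[OF z p(1)]] gauge_hom(4)[OF z p(1) p(1)] p(2) by metis
  define C where "C = sphere (0::complex) 1"
  have conn: "connected (poly f ` C)"
    unfolding C_def by (intro connected_continuous_image continuous_intros connected_sphere) simp
  have sub: "poly f ` C \<subseteq> ball 0 (1/4) \<union> ball 1 (1/4)"
    using fz id by (fastforce simp: C_def dist_norm norm_minus_commute)
  have disj: "ball 0 (1/4) \<inter> ball 1 (1/4) = ({} :: complex set)"
  proof -
    have False if "cmod x < 1/4" "cmod (1 - x) < 1/4" for x :: complex
      using norm_triangle_ineq[of x "1 - x"] that by simp
    then show ?thesis by (auto simp: dist_norm)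
  qed
  have one: "1 \<in> C" by (simp add: C_def)
  have g1: "gauge 1 p = p"
  proof -
    have "gauge 1 p x u = p x u" if x: "x \<in> ell2 Pa" for x u
    proof -
      have "wcomp Pa id (\<lambda>u. 1) y = y" if "y \<in> ell2 Pa" for y
        using ell2_outside[OF that] by (auto simp: wcomp_def)
      then show ?thesis using x bop_in_ell2[OF X_bop[OF p(1)]] by (simp add: gauge_def unitary_conj_def)
    qed
    then show ?thesis using X_bop[OF p(1)] X_bop[OF gauge_X[of 1, OF _ p(1)]] by (intro bop_eqI) auto
  qed
  \<comment> \<open>By connectedness the curve stays in one of the discs; the point
    \<open>z = 1\<close>, where the gauge action is trivial, shows that this disc is centred at
    \<rho>(p).\<close>
  have const: "cmod (poly f z - \<rho> p) < 1/4" if "z \<in> C" for z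
  proof (cases "ball 0 (1/4) \<inter> poly f ` C = {}")
    case True
    then have *: "poly f w \<in> ball 1 (1/4)" if "w \<in> C" for w using sub that by blast
    then have "cmod (1 - poly f 1) < 1 / 4" using one by (simp add: dist_norm)
    then have "\<rho> p \<noteq> 0"
      using fz[of 1] norm_triangle_ineq[of "poly f 1" "1 - poly f 1"] by (auto simp: g1)
    then have "\<rho> p = 1" using id[of 1] by (simp add: g1)
    then show ?thesis using *[OF that] by (simp add: dist_norm norm_minus_commute)
  next
    case False
    then have "ball 1 (1/4) \<inter> poly f ` C = {}"
      using connectedD[OF conn open_ball[of 0 "1/4"] open_ball[of 1 "1/4"]] disj sub by blast
    then have *: "poly f w \<in> ball 0 (1/4)" if "w \<in> C" for w using sub that by blast
    then have "cmod (poly f 1) < 1 / 4" using one by (simp add: dist_norm)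
    then have "\<rho> p \<noteq> 1"
      using fz[of 1] norm_triangle_ineq[of "poly f 1" "1 - poly f 1"] by (auto simp: g1)
    then have "\<rho> p = 0" using id[of 1] by (simp add: g1)
    then show ?thesis using *[OF that] by (simp add: dist_norm)
  qed
  have "cmod (poly f 0 - \<rho> p) \<le> 1/4"
    by (rule maximum_modulus_frontier[of "\<lambda>z. poly f z - \<rho> p" "ball 0 1"])
      (use const in \<open>auto simp: C_def less_imp_le intro!: holomorphic_intros continuous_intros\<close>)
  then have "cmod (vac v p - \<rho> p) < 1"
    using f0 norm_triangle_ineq[of "vac v p - poly f 0" "poly f 0 - \<rho> p"] by simp
  then show ?thesis
    using character_idempotent[OF \<rho>(1) p] character_idempotent[OF vac_character[OF \<rho>(3)] p] by auto
qed

end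

section \<open>From algebra isomorphisms to graph isomorphisms\<close>

lemma underdetermined_system:
  fixes M :: "'i \<Rightarrow> 'j \<Rightarrow> 'a::field"
  assumes "finite I" "finite F" "card I < card F"
  shows "\<exists>c. (\<exists>f\<in>F. c f \<noteq> 0) \<and> (\<forall>i\<in>I. (\<Sum>f\<in>F. c f * M i f) = 0)"
  using assms
proof (induction I arbitrary: F M rule: finite_induct)
  case empty
  then have "F \<noteq> {}" by auto
  then show ?case by (intro exI[of _ "\<lambda>_. 1"]) auto
next
  case (insert i I)
  show ?case
  proof (cases "\<forall>f\<in>F. M i f = 0")
    case True
    have "card I < card F" using insert by simp
    then show ?thesis using insert.IH[OF insert.prems(1), of M] True by auto
  next
    case False
    \<comment> \<open>Gaussian elimination with pivot \<open>g\<close>: subtracting a multiple of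
      row \<open>i\<close> from each row \<open>j\<close> removes the unknown \<open>g\<close>, and
      \<open>a\<close> below is the value that equation \<open>i\<close> then forces on it.\<close>
    then obtain g where g: "g \<in> F" "M i g \<noteq> 0" by auto
    let ?F = "F - {g}"
    have "card I < card ?F" using insert g by simp
    then obtain c where c: "\<exists>f\<in>?F. c f \<noteq> 0"
      "\<And>j. j \<in> I \<Longrightarrow> (\<Sum>f\<in>?F. c f * (M j f - M j g * M i f / M i g)) = 0"
      using insert.IH[of ?F "\<lambda>j f. M j f - M j g * M i f / M i g"] insert.prems(1) by auto
    define a where "a = - (\<Sum>f\<in>?F. c f * M i f) / M i g"
    define c' where "c' = c(g := a)"
    have sum: "(\<Sum>f\<in>F. c' f * M j f) = a * M j g + (\<Sum>f\<in>?F. c f * M j f)" for j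
      using sum.remove[OF insert.prems(1) g(1), of "\<lambda>f. c' f * M j f"] by (simp add: c'_def)
    have "(\<Sum>f\<in>F. c' f * M j f) = 0" if "j \<in> I" for j
    proof -
      have "0 = (\<Sum>f\<in>?F. c f * M j f) - (\<Sum>f\<in>?F. c f * M i f * (M j g / M i g))"
        using c(2)[OF that] by (simp add: right_diff_distrib sum_subtractf mult_ac)
      also have "(\<Sum>f\<in>?F. c f * M i f * (M j g / M i g)) = - a * M j g"
        unfolding sum_distrib_right[symmetric] by (simp add: a_def)
      finally show ?thesis using sum[of j] by (simp add: add.commute)
    qed
    moreover have "(\<Sum>f\<in>F. c' f * M i f) = 0" using sum[of i] g by (simp add: a_def)
    ultimately show ?thesis using c(1) by (intro exI[of _ c']) (auto simp: c'_def)
  qed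
qed

text \<open>The comparison is demanded only against a finite opposite set, which is all that
  counting equations can give; two infinite countable sets are equinumerous anyway.\<close>

lemma countable_bij_betw_if_finite_subsets:
  assumes "countable A" "countable B"
    and AB: "\<And>F. finite F \<Longrightarrow> F \<subseteq> A \<Longrightarrow> finite B \<Longrightarrow> card F \<le> card B"
    and BA: "\<And>F. finite F \<Longrightarrow> F \<subseteq> B \<Longrightarrow> finite A \<Longrightarrow> card F \<le> card A"
  shows "\<exists>h. bij_betw h A B"
proof (cases "finite A"; cases "finite B")
  assume "finite A" "finite B"
  then show ?thesis using AB[of A] BA[of B] finite_same_card_bij[of A B] by auto
next
  assume "finite A" "infinite B"
  then show ?thesis using BA infinite_arbitrarily_large[of B "Suc (card A)"] by fastforce
next
  assume "infinite A" "finite B"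
  then show ?thesis using AB infinite_arbitrarily_large[of A "Suc (card B)"] by fastforce
next
  assume "infinite A" "infinite B"
  then show ?thesis
    using bij_betw_trans[OF to_nat_on_infinite[OF assms(1)] bij_betw_inv_into[OF to_nat_on_infinite[OF assms(2)]]]
    by blast
qed

text \<open>Closure of \<open>X\<close> under the operations is what allows the inverse to be
  evaluated at sums, multiples and products of images.\<close>

lemma bicont_alg_iso_inverse:
  assumes iso: "bicont_alg_iso A B X Y \<tau>"
    and add: "\<And>T S. T \<in> X \<Longrightarrow> S \<in> X \<Longrightarrow> op_add T S \<in> X"
    and scale: "\<And>c T. T \<in> X \<Longrightarrow> op_scale c T \<in> X"
    and comp: "\<And>T S. T \<in> X \<Longrightarrow> S \<in> X \<Longrightarrow> T \<circ> S \<in> X"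
  shows "bicont_alg_iso B A Y X (the_inv_into X \<tau>)"
proof -
  let ?i = "the_inv_into X \<tau>"
  have bij: "bij_betw \<tau> X Y" using iso by (simp add: bicont_alg_iso_def)
  then have inj: "inj_on \<tau> X" and img: "\<tau> ` X = Y" by (auto simp: bij_betw_def)
  have bij': "bij_betw ?i Y X" using bij by (rule bij_betw_the_inv_into)
  have i: "?i T \<in> X" "\<tau> (?i T) = T" if "T \<in> Y" for T
    using that inj img by (auto simp: the_inv_into_f_f)
  have ii: "?i (\<tau> T) = T" if "T \<in> X" for T using that inj by (rule the_inv_into_f_f[rotated])
  have double_inv: "the_inv_into Y ?i T = \<tau> T" if "T \<in> X" for T
    using that ii inj bij' img by (intro the_inv_into_f_eq) (auto simp: bij_betw_def)
  have "op_continuous_on A B X (the_inv_into Y ?i)"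
    using iso double_inv by (simp add: bicont_alg_iso_def op_continuous_on_def)
  moreover have "?i (op_add T S) = op_add (?i T) (?i S)" if "T \<in> Y" "S \<in> Y" for T S
    using ii[OF add[OF i(1)[OF that(1)] i(1)[OF that(2)]]] iso i that by (simp add: bicont_alg_iso_def)
  moreover have "?i (op_scale c T) = op_scale c (?i T)" if "T \<in> Y" for c T
    using ii[OF scale[OF i(1)[OF that]], of c] iso i that by (simp add: bicont_alg_iso_def)
  moreover have "?i (T \<circ> S) = ?i T \<circ> ?i S" if "T \<in> Y" "S \<in> Y" for T S
  proof -
    have "\<tau> (?i T \<circ> ?i S) = \<tau> (?i T) \<circ> \<tau> (?i S)"
      using iso i(1) that unfolding bicont_alg_iso_def by blast
    then show ?thesis using ii[OF comp[OF i(1)[OF that(1)] i(1)[OF that(2)]]] i(2) that by metis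
  qed
  ultimately show ?thesis using iso bij' by (auto simp: bicont_alg_iso_def)
qed

text \<open>Functionals are pulled back, so everything constructed here on graphs runs against
  \<tau>: from the vertices and edges of \<open>H\<close> to those of \<open>G\<close>.\<close>

locale tensor_iso =
  G: digraph V E r s + H: digraph V' E' r' s'
  for V :: "'v set" and E :: "'e set" and r s and V' :: "'w set" and E' :: "'f set" and r' s' +
  fixes \<tau>
  assumes iso: "bicont_alg_iso G.Pa H.Pa G.X H.X \<tau>"
begin

lemma inverse_iso: "tensor_iso V' E' r' s' V E r s (the_inv_into G.X \<tau>)"
  by (intro tensor_iso.intro tensor_iso_axioms.intro G.digraph_axioms H.digraph_axioms
      bicont_alg_iso_inverse[OF iso] G.add_X G.scale_X G.comp_X)

lemma \<tau>_bij: "bij_betw \<tau> G.X H.X"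
  using iso by (simp add: bicont_alg_iso_def)

lemma \<tau>_X: "T \<in> G.X \<Longrightarrow> \<tau> T \<in> H.X"
  using \<tau>_bij by (auto simp: bij_betw_def)

lemma \<tau>_add: "T \<in> G.X \<Longrightarrow> S \<in> G.X \<Longrightarrow> \<tau> (op_add T S) = op_add (\<tau> T) (\<tau> S)"
  and \<tau>_scale: "T \<in> G.X \<Longrightarrow> \<tau> (op_scale c T) = op_scale c (\<tau> T)"
  using iso by (auto simp: bicont_alg_iso_def)

lemma \<tau>_comp: "T \<in> G.X \<Longrightarrow> S \<in> G.X \<Longrightarrow> \<tau> (T \<circ> S) = \<tau> T \<circ> \<tau> S"
  using iso unfolding bicont_alg_iso_def by blast

lemma \<tau>_zero: "\<tau> (\<lambda>x. 0) = (\<lambda>x. 0)"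
  using \<tau>_scale[OF G.zero_X, of 0] by (simp add: op_scale_0)

lemma \<tau>_inverse:
  assumes "S \<in> H.X"
  shows "the_inv_into G.X \<tau> S \<in> G.X" "\<tau> (the_inv_into G.X \<tau> S) = S"
  using assms \<tau>_bij f_the_inv_into_f_bij_betw the_inv_into_into by (fastforce simp: bij_betw_def)+

lemma \<tau>_inverse': "T \<in> G.X \<Longrightarrow> the_inv_into G.X \<tau> (\<tau> T) = T"
  using \<tau>_bij by (simp add: bij_betw_def the_inv_into_f_f)

section \<open>Pulling back functionals, derivations and characters\<close>

lemma functional_pull:
  assumes \<rho>: "H.functional \<rho>"
  shows "G.functional (\<lambda>T. \<rho> (\<tau> T))"
  unfolding G.functional_def
proof (intro conjI ballI allI impI)
  fix \<epsilon> :: real assume "\<epsilon> > 0"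
  then obtain \<delta> where d: "\<delta> > 0" "\<And>T. T \<in> H.X \<Longrightarrow> opnorm H.Pa T < \<delta> \<Longrightarrow> cmod (\<rho> T) < \<epsilon>"
    using H.functional_cont[OF \<rho>] by metis
  have "op_continuous_on G.Pa H.Pa G.X \<tau>" using iso by (simp add: bicont_alg_iso_def)
  then obtain \<eta> where e: "\<eta> > 0"
    "\<And>S. S \<in> G.X \<Longrightarrow> opnorm G.Pa (op_diff S (\<lambda>x. 0)) < \<eta> \<Longrightarrow> opnorm H.Pa (op_diff (\<tau> S) (\<tau> (\<lambda>x. 0))) < \<delta>"
    using G.zero_X d(1) unfolding op_continuous_on_def by meson
  then show "\<exists>\<delta>>0. \<forall>T\<in>G.X. opnorm G.Pa T < \<delta> \<longrightarrow> cmod (\<rho> (\<tau> T)) < \<epsilon>"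
    using d(2)[OF \<tau>_X] unfolding \<tau>_zero op_diff_def by (intro exI[of _ \<eta>]) auto
qed (simp_all add: \<tau>_add \<tau>_scale \<tau>_X H.functional_add[OF \<rho>] H.functional_scale[OF \<rho>])

lemma derivation_pull:
  assumes "H.derivation \<rho> \<sigma> d"
  shows "G.derivation (\<lambda>T. \<rho> (\<tau> T)) (\<lambda>T. \<sigma> (\<tau> T)) (\<lambda>T. d (\<tau> T))"
  unfolding G.derivation_def
proof (intro conjI ballI)
  fix T S assume "T \<in> G.X" "S \<in> G.X"
  then show "d (\<tau> (T \<circ> S)) = \<rho> (\<tau> T) * d (\<tau> S) + d (\<tau> T) * \<sigma> (\<tau> S)"
    using assms \<tau>_X unfolding H.derivation_def by (simp only: \<tau>_comp)
qed (use assms functional_pull in \<open>simp add: H.derivation_def\<close>)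

lemma character_pull:
  assumes "H.character \<rho>"
  shows "G.character (\<lambda>T. \<rho> (\<tau> T))"
  unfolding G.character_def
proof (intro conjI ballI)
  fix T S assume "T \<in> G.X" "S \<in> G.X"
  then show "\<rho> (\<tau> (T \<circ> S)) = \<rho> (\<tau> T) * \<rho> (\<tau> S)"
    using assms \<tau>_X unfolding H.character_def by (simp only: \<tau>_comp)
next
  obtain S where "S \<in> H.X" "\<rho> S \<noteq> 0" using H.character_nonzero[OF assms] by blast
  then show "\<exists>T\<in>G.X. \<rho> (\<tau> T) \<noteq> 0" using \<tau>_inverse by metis
qed (use assms functional_pull in \<open>simp add: H.character_def\<close>)

section \<open>The induced vertex map and the comparison of edges\<close>

definition vertex_map :: "'w \<Rightarrow> 'v" where
  "vertex_map w = (THE v. v \<in> V \<and> H.vac w (\<tau> (G.P v)) = 1)"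

lemma vertex_map:
  assumes "w \<in> V'"
  shows "vertex_map w \<in> V" "H.vac w (\<tau> (G.P (vertex_map w))) = 1"
  using theI'[OF G.character_vertex[OF character_pull[OF H.vac_character[OF assms]]]]
  unfolding vertex_map_def by auto

lemma vertex_map_eq:
  assumes "w \<in> V'" "v \<in> V" "H.vac w (\<tau> (G.P v)) = 1"
  shows "vertex_map w = v"
  using G.character_vertex[OF character_pull[OF H.vac_character[OF assms(1)]]] vertex_map[OF assms(1)] assms
  by blast

text \<open>The pulled-back character is 1 on the projection of \<open>vertex_map w\<close> but need
  not be a vacuum character; on idempotents the difference is invisible. This is what makes the
  vertex maps of \<tau> and its inverse mutually inverse.\<close>

lemma vac_pull_idempotent:
  assumes w: "w \<in> V'" and p: "p \<in> G.X" "p \<circ> p = p"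
  shows "H.vac w (\<tau> p) = G.vac (vertex_map w) p"
  by (rule G.character_idempotent_eq_vac[OF character_pull[OF H.vac_character[OF w]] _ _ p])
    (use vertex_map[OF w] in auto)

lemma card_edges_le:
  assumes w: "w1 \<in> V'" "w2 \<in> V'" and F: "finite F" "F \<subseteq> {f \<in> E'. r' f = w1 \<and> s' f = w2}"
    and D: "finite {e \<in> E. r e = vertex_map w1 \<and> s e = vertex_map w2}"
  shows "card F \<le> card {e \<in> E. r e = vertex_map w1 \<and> s e = vertex_map w2}" (is "_ \<le> card ?D")
proof (rule ccontr)
  assume "\<not> card F \<le> card ?D"
  \<comment> \<open>One unknown for each edge in \<open>F\<close> and one equation for each edge in
    \<open>?D\<close>: too large an \<open>F\<close> admits a nontrivial combination of edge
    derivations whose pull-back kills every L_e with \<open>e\<close> in \<open>?D\<close>, hence is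
    inner.\<close>
  then obtain c where c: "\<exists>f\<in>F. c f \<noteq> 0" "\<And>e. e \<in> ?D \<Longrightarrow> (\<Sum>f\<in>F. c f * H.edge f (\<tau> (G.L e))) = 0"
    using underdetermined_system[OF D F(1), of "\<lambda>e f. H.edge f (\<tau> (G.L e))"] by auto
  define d where "d = (\<lambda>T. \<Sum>f\<in>F. c f * H.edge f T)"
  have "H.derivation (H.vac w1) (H.vac w2) (H.edge f)" if "f \<in> F" for f
    using H.edge_derivation[of f] F(2) that by auto
  then have d: "H.derivation (H.vac w1) (H.vac w2) d"
    unfolding d_def by (rule H.derivation_sum[OF F(1)])
  obtain a where a: "vertex_map w2 = vertex_map w1 \<longrightarrow> a = 0"
    "\<forall>T\<in>G.X. d (\<tau> T) = a * (H.vac w1 (\<tau> T) - H.vac w2 (\<tau> T))"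
    using G.derivation_inner[OF character_pull[OF H.vac_character[OF w(1)]] vertex_map(2,1)[OF w(1)]
        character_pull[OF H.vac_character[OF w(2)]] vertex_map(2,1)[OF w(2)] derivation_pull[OF d]]
      c(2) unfolding d_def by auto
  have da: "d S = a * (H.vac w1 S - H.vac w2 S)" if "S \<in> H.X" for S
    using a(2) \<tau>_inverse[OF that] by metis
  have "d (H.P w1) = 0"
    unfolding d_def using F(2) by (intro sum.neutral) (auto simp: H.edge_P)
  \<comment> \<open>For distinct vertices the inner derivation is 1 on \<open>P w1\<close>, where
    \<open>d\<close> vanishes; for equal ones \<open>a = 0\<close> comes from
    \<open>derivation_inner\<close>.\<close>
  then have a0: "a = 0"
    using da[OF H.P_X[OF w(1)]] w a(1) by (cases "w1 = w2") (auto simp: H.vac_P)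
  \<comment> \<open>The edge derivations are dual to the operators L_f, so evaluating
    \<open>d\<close> at L_f reads off the coefficient.\<close>
  have "c f = 0" if f: "f \<in> F" for f
  proof -
    have E: "g \<in> E'" if "g \<in> F" for g using F(2) that by auto
    have "d (H.L f) = (\<Sum>g\<in>F. if g = f then c g else 0)"
      unfolding d_def by (intro sum.cong) (auto simp: H.edge_L E)
    also have "\<dots> = c f" using F(1) f by simp
    finally show ?thesis using da[OF H.L_X[OF E[OF f]]] a0 by simp
  qed
  then show False using c(1) by auto
qed

lemma graph_iso: "graph_iso V' E' r' s' V E r s"
proof -
  interpret I: tensor_iso V' E' r' s' V E r s "the_inv_into G.X \<tau>" by (rule inverse_iso)
  let ?\<phi> = vertex_map and ?\<psi> = I.vertex_map
  have 1: "?\<phi> (?\<psi> v) = v" if v: "v \<in> V" for v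
  proof (rule vertex_map_eq)
    \<comment> \<open>\<tau>(P_v) is idempotent, so the inverse isomorphism may compare vacuum
      values on it: at \<open>?\<psi> v\<close> it takes the value that \<open>G.vac v\<close> takes
      on P_v, namely 1. That characterises \<open>v\<close> as the image of
      \<open>?\<psi> v\<close>.\<close>
    have "\<tau> (G.P v) \<circ> \<tau> (G.P v) = \<tau> (G.P v)"
      using \<tau>_comp[OF G.P_X G.P_X, OF v v] G.P_comp_P[of v] by simp
    from I.vac_pull_idempotent[OF v \<tau>_X[OF G.P_X[OF v]] this]
    show "H.vac (?\<psi> v) (\<tau> (G.P v)) = 1"
      by (simp add: \<tau>_inverse' G.P_X v G.vac_P)
  qed (use v I.vertex_map in auto)
  have 2: "?\<psi> (?\<phi> w) = w" if w: "w \<in> V'" for w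
  proof (rule I.vertex_map_eq)
    let ?p = "the_inv_into G.X \<tau> (H.P w)"
    have "?p \<circ> ?p = ?p"
      using I.\<tau>_comp[OF H.P_X H.P_X, OF w w] H.P_comp_P[of w] by simp
    from vac_pull_idempotent[OF w \<tau>_inverse(1)[OF H.P_X[OF w]] this]
    show "G.vac (?\<phi> w) ?p = 1"
      by (simp add: \<tau>_inverse H.P_X w H.vac_P)
  qed (use w vertex_map in auto)
  have bij: "bij_betw ?\<phi> V' V"
    by (rule bij_betw_byWitness[where f' = ?\<psi>]) (use 1 2 vertex_map I.vertex_map in auto)
  define EH where "EH a b = {f \<in> E'. r' f = a \<and> s' f = b}" for a b
  define EG where "EG a b = {e \<in> E. r e = a \<and> s e = b}" for a b
  have "\<exists>h. bij_betw h (EH a b) (EG (?\<phi> a) (?\<phi> b))" if ab: "a \<in> V'" "b \<in> V'" for a b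
  proof (rule countable_bij_betw_if_finite_subsets)
    show "countable (EH a b)" "countable (EG (?\<phi> a) (?\<phi> b))"
      using G.countable_digraph H.countable_digraph
      by (auto simp: countable_digraph_def EH_def EG_def intro: countable_subset[rotated])
    show "card F \<le> card (EG (?\<phi> a) (?\<phi> b))"
      if "finite F" "F \<subseteq> EH a b" "finite (EG (?\<phi> a) (?\<phi> b))" for F
      using card_edges_le[OF ab] that unfolding EH_def EG_def by blast
    show "card F \<le> card (EH a b)" if "finite F" "F \<subseteq> EG (?\<phi> a) (?\<phi> b)" "finite (EH a b)" for F
      using I.card_edges_le[OF vertex_map(1)[OF ab(1)] vertex_map(1)[OF ab(2)], of F] that 2 ab
      unfolding EH_def EG_def by simp
  qed
  then obtain h where h: "\<And>a b. a \<in> V' \<Longrightarrow> b \<in> V' \<Longrightarrow> bij_betw (h a b) (EH a b) (EG (?\<phi> a) (?\<phi> b))"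
    by metis
  \<comment> \<open>The bijections chosen for each pair of vertices are glued. They do not collide,
    because the ends of \<open>k f\<close> determine those of \<open>f\<close> through the injective
    vertex map.\<close>
  define k where "k f = h (r' f) (s' f) f" for f
  have k: "k f \<in> E \<and> r (k f) = ?\<phi> (r' f) \<and> s (k f) = ?\<phi> (s' f)" if "f \<in> E'" for f
    using bij_betw_apply[OF h[of "r' f" "s' f"], of f] that by (auto simp: k_def EH_def EG_def)
  have "inj_on k E'"
  proof (rule inj_onI)
    fix f g assume fg: "f \<in> E'" "g \<in> E'" "k f = k g"
    then have "?\<phi> (r' f) = ?\<phi> (r' g)" "?\<phi> (s' f) = ?\<phi> (s' g)" using k by metis+
    then have eq: "r' f = r' g" "s' f = s' g"
      using fg bij by (auto simp: bij_betw_def inj_on_eq_iff)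
    have "inj_on (h (r' f) (s' f)) (EH (r' f) (s' f))"
      using h[of "r' f" "s' f"] fg by (simp add: bij_betw_def)
    then show "f = g" using fg eq by (auto simp: k_def EH_def inj_on_def)
  qed
  moreover have "k ` E' = E"
  proof
    show "k ` E' \<subseteq> E" using k by auto
    show "E \<subseteq> k ` E'"
    proof
      fix e assume e: "e \<in> E"
      let ?a = "?\<psi> (r e)" and ?b = "?\<psi> (s e)"
      have V: "?a \<in> V'" "?b \<in> V'" using e I.vertex_map(1) by auto
      have "e \<in> EG (?\<phi> ?a) (?\<phi> ?b)" using e 1 by (simp add: EG_def)
      then have "e \<in> h ?a ?b ` EH ?a ?b" using h[OF V] by (simp add: bij_betw_def)
      then obtain f where f: "f \<in> E'" "r' f = ?a" "s' f = ?b" "e = h ?a ?b f" by (auto simp: EH_def)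
      then have "e = k f" by (simp add: k_def)
      then show "e \<in> k ` E'" using f(1) by blast
    qed
  qed
  ultimately have "bij_betw k E' E" by (simp add: bij_betw_def)
  then show ?thesis using bij k unfolding graph_iso_def by blast
qed

end

section \<open>From graph isomorphisms to algebra isomorphisms\<close>

lemma map_gpath_in_paths:
  assumes "\<phi> ` V \<subseteq> V'" "\<psi> ` E \<subseteq> E'"
    and "\<And>e. e \<in> E \<Longrightarrow> r' (\<psi> e) = \<phi> (r e) \<and> s' (\<psi> e) = \<phi> (s e)" and "w \<in> paths V E r s"
  shows "map_gpath \<phi> \<psi> w \<in> paths V' E' r' s'"
proof (cases w)
  case (Px es)
  then have es: "es \<noteq> []" "set es \<subseteq> E" "\<And>i. Suc i < length es \<Longrightarrow> s (es ! i) = r (es ! Suc i)"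
    using assms(4) by (auto simp: paths_def)
  have "s' (map \<psi> es ! i) = r' (map \<psi> es ! Suc i)" if "Suc i < length es" for i
  proof -
    have "es ! i \<in> E" "es ! Suc i \<in> E" using es(2) that by (auto simp: subset_iff)
    then show ?thesis using assms(3) es(3)[OF that] that by simp
  qed
  moreover have "\<psi> ` set es \<subseteq> E'" using es(2) assms(2) by blast
  ultimately show ?thesis using Px es unfolding paths_def by (intro UnI2) (auto intro!: imageI)
qed (use assms in \<open>auto simp: paths_def\<close>)

text \<open>Conjugation by a unitary is isometric in both directions, so continuity is immediate;
  matching generators make it map one closed algebra onto the other.\<close>

lemma bicont_alg_iso_unitary_conj:
  assumes "ell2_unitary A B U W" "Gs \<subseteq> bop A" "Hs \<subseteq> bop B"
    and GH: "unitary_conj B U W ` Gs = Hs"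
  shows "bicont_alg_iso A B (norm_closure A (alg_gen Gs)) (norm_closure B (alg_gen Hs)) (unitary_conj B U W)"
    (is "bicont_alg_iso A B ?X ?Y _")
proof -
  interpret U: ell2_unitary A B U W by fact
  interpret W: ell2_unitary B A W U by (rule U.inverse_unitary)
  have X: "T \<in> bop A" if "T \<in> ?X" for T using that by (rule norm_closure_bop)
  have Y: "T \<in> bop B" if "T \<in> ?Y" for T using that by (rule norm_closure_bop)
  have UX: "U.cj T \<in> ?Y" if "T \<in> ?X" for T
    by (rule U.cj_norm_closure[OF assms(2) _ that]) (use GH in \<open>auto intro: alg_gen.gen\<close>)
  have WY: "W.cj T \<in> ?X" if "T \<in> ?Y" for T
  proof (rule W.cj_norm_closure[OF assms(3) _ that])
    fix S assume "S \<in> Hs"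
    then obtain R where "R \<in> Gs" "S = U.cj R" using GH by auto
    then have "W.cj S = R" "R \<in> alg_gen Gs" using assms(2) U.cj_inverse[of R] by (auto intro: alg_gen.gen)
    then show "W.cj S \<in> alg_gen Gs" by simp
  qed
  have WU: "W.cj (U.cj T) = T" if "T \<in> ?X" for T using U.cj_inverse[OF X[OF that]] .
  have UW: "U.cj (W.cj T) = T" if "T \<in> ?Y" for T using W.cj_inverse[OF Y[OF that]] .
  have bij: "bij_betw U.cj ?X ?Y"
    by (rule bij_betw_byWitness[where f' = W.cj]) (use WU UW UX WY in auto)
  have inv: "the_inv_into ?X U.cj T = W.cj T" if "T \<in> ?Y" for T
    using bij UW WY that by (intro the_inv_into_f_eq) (auto simp: bij_betw_def)
  have "op_continuous_on A B ?X U.cj"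
    unfolding op_continuous_on_def using U.cj_diff U.opnorm_cj bop_op_diff X by metis
  moreover have "op_continuous_on B A ?Y (the_inv_into ?X U.cj)"
    unfolding op_continuous_on_def using W.cj_diff W.opnorm_cj bop_op_diff Y inv by metis
  ultimately show ?thesis
    using bij by (auto simp: bicont_alg_iso_def U.cj_add U.cj_scale U.cj_comp X simp del: comp_apply)
qed

lemma graph_iso_imp_tensor_iso:
  assumes G: "countable_digraph V E r s" and H: "countable_digraph V' E' r' s'"
    and iso: "graph_iso V E r s V' E' r' s'"
  shows "\<exists>\<tau>. bicont_alg_iso (paths V E r s) (paths V' E' r' s') (tensor_alg V E r s) (tensor_alg V' E' r' s') \<tau>"
proof -
  interpret G: digraph V E r s by (unfold_locales) (rule G)
  interpret H: digraph V' E' r' s' by (unfold_locales) (rule H)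
  obtain \<phi> \<psi> where \<phi>: "bij_betw \<phi> V V'" and \<psi>: "bij_betw \<psi> E E'"
    and rs: "\<And>e. e \<in> E \<Longrightarrow> r' (\<psi> e) = \<phi> (r e) \<and> s' (\<psi> e) = \<phi> (s e)"
    using iso unfolding graph_iso_def by blast
  define \<phi>' where "\<phi>' = the_inv_into V \<phi>"
  define \<psi>' where "\<psi>' = the_inv_into E \<psi>"
  have \<phi>': "\<And>v. v \<in> V \<Longrightarrow> \<phi> v \<in> V' \<and> \<phi>' (\<phi> v) = v" "\<And>w. w \<in> V' \<Longrightarrow> \<phi>' w \<in> V \<and> \<phi> (\<phi>' w) = w"
    using \<phi> by (auto simp: \<phi>'_def bij_betw_def the_inv_into_f_f)
  have \<psi>': "\<And>v. v \<in> E \<Longrightarrow> \<psi> v \<in> E' \<and> \<psi>' (\<psi> v) = v" "\<And>w. w \<in> E' \<Longrightarrow> \<psi>' w \<in> E \<and> \<psi> (\<psi>' w) = w"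
    using \<psi> by (auto simp: \<psi>'_def bij_betw_def the_inv_into_f_f)
  have rs': "r (\<psi>' f) = \<phi>' (r' f) \<and> s (\<psi>' f) = \<phi>' (s' f)" if "f \<in> E'" for f
    using rs[of "\<psi>' f"] \<psi>'(2)[OF that] \<phi>'(1) by (metis G.r_in_V G.s_in_V)
  define h where "h = map_gpath \<phi> \<psi>"
  define g where "g = map_gpath \<phi>' \<psi>'"
  have hP: "h w \<in> H.Pa" if "w \<in> G.Pa" for w
    unfolding h_def by (rule map_gpath_in_paths[where V = V and E = E and r = r and s = s])
      (use that rs \<phi>' \<psi>' in auto)
  have gP: "g w \<in> G.Pa" if "w \<in> H.Pa" for w
    unfolding g_def by (rule map_gpath_in_paths[where V = V' and E = E' and r = r' and s = s'])
      (use that rs' \<phi>' \<psi>' in auto)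
  have gh: "g (h w) = w" if "w \<in> G.Pa" for w
    using that \<phi>' \<psi>' by (auto simp: g_def h_def paths_def subset_iff intro!: map_idI)
  have hg: "h (g w) = w" if "w \<in> H.Pa" for w
    using that \<phi>' \<psi>' by (auto simp: g_def h_def paths_def subset_iff intro!: map_idI)
  \<comment> \<open>Coordinates are read through the inverse path map, so \<open>?U\<close> sends
    \<xi>_w to \<xi>_{h w}.\<close>
  let ?U = "wcomp H.Pa g (\<lambda>_. 1)" and ?W = "wcomp G.Pa h (\<lambda>_. 1)"
  have un: "ell2_unitary G.Pa H.Pa ?U ?W"
    using wcomp_unitary[of G.Pa h H.Pa g "\<lambda>_. 1"] hP gP gh hg by simp
  interpret U: ell2_unitary G.Pa H.Pa ?U ?W by (rule un)
  have P: "U.cj (G.P v) = H.P (\<phi> v)" if v: "v \<in> V" for v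
  proof (rule bop_eqI[OF U.cj_bop[OF G.P_bop] H.P_bop])
    fix y u assume y: "y \<in> ell2 H.Pa"
    have "prange r (g u) = v \<longleftrightarrow> prange r' u = \<phi> v" if u: "u \<in> H.Pa"
    proof -
      have "prange r (g u) = \<phi>' (prange r' u)" "prange r' u \<in> V'"
        using u rs' by (cases u; auto simp: g_def paths_def hd_map subset_iff)+
      then show ?thesis using \<phi>' v by metis
    qed
    then show "U.cj (G.P v) y u = H.P (\<phi> v) y u"
      using y U.W_ell2[OF y] gP hg by (auto simp: unitary_conj_def G.P_apply H.P_apply wcomp_def)
  qed
  have L: "U.cj (G.L e) = H.L (\<psi> e)" if e: "e \<in> E" for e
  proof (rule bop_eqI[OF U.cj_bop[OF G.L_bop] H.L_bop])
    fix y u assume y: "y \<in> ell2 H.Pa"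
    have *: "(\<exists>es. g u = Px (e # es)) \<longleftrightarrow> (\<exists>es. u = Px (\<psi> e # es))" if u: "u \<in> H.Pa"
    proof
      assume "\<exists>es. g u = Px (e # es)"
      then show "\<exists>es. u = Px (\<psi> e # es)" using hg[OF u] by (auto simp: h_def)
    next
      assume "\<exists>es. u = Px (\<psi> e # es)"
      then show "\<exists>es. g u = Px (e # es)" using \<psi>' e by (auto simp: g_def)
    qed
    have **: "h (ptail s (g u)) = ptail s' u \<and> ptail s (g u) \<in> G.Pa"
      if u: "u \<in> H.Pa" "u = Px (\<psi> e # es)" for es
    proof -
      have gu: "g u = Px (e # map \<psi>' es)" using u(2) \<psi>' e by (simp add: g_def)
      then have hu: "u = Px (\<psi> e # map \<psi> (map \<psi>' es))" using hg[OF u(1)] by (simp add: h_def)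
      have "ptail s (g u) \<in> G.Pa" using gP[OF u(1)] gu G.ptail_in_paths by simp
      \<comment> \<open>The tail of a one-edge word is its source vertex; this is where
        compatibility of \<open>\<psi>\<close> with the source maps enters.\<close>
      moreover have "h (ptail s (Px (e # map \<psi>' es))) = ptail s' (Px (\<psi> e # map \<psi> (map \<psi>' es)))"
        unfolding G.ptail_Cons H.ptail_Cons using rs[OF e] by (simp add: h_def)
      ultimately show ?thesis using gu hu by metis
    qed
    show "U.cj (G.L e) y u = H.L (\<psi> e) y u"
    proof (cases "u \<in> H.Pa")
      case True
      have "U.cj (G.L e) y u = G.L e (?W y) (g u)" using y True by (simp add: unitary_conj_def wcomp_def)
      also have "\<dots> = (if \<exists>es. u = Px (\<psi> e # es) then ?W y (ptail s (g u)) else 0)"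
        using *[OF True] gP[OF True] by (simp add: G.L_apply[OF U.W_ell2[OF y]])
      also have "\<dots> = (if \<exists>es. u = Px (\<psi> e # es) then y (ptail s' u) else 0)"
        using **[OF True] by (intro if_cong refl) (metis wcomp_def mult_1)
      also have "\<dots> = H.L (\<psi> e) y u"
        using True by (simp add: H.L_apply[OF y])
      finally show ?thesis .
    next
      case False
      then show ?thesis using y by (simp add: unitary_conj_def wcomp_def H.L_apply)
    qed
  qed
  have "U.cj ` G.Gs = H.L ` (\<psi> ` E) \<union> H.P ` (\<phi> ` V)"
    unfolding image_Un image_image using L P by simp
  also have "\<dots> = H.Gs" using \<phi> \<psi> by (simp add: bij_betw_def)
  finally show ?thesis
    using bicont_alg_iso_unitary_conj[OF un G.Gs_bop H.Gs_bop] unfolding tensor_alg_def by blast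
qed

theorem theorem2p9:
  fixes V :: "'v set" and E :: "'e set" and r s :: "'e \<Rightarrow> 'v"
    and V' :: "'w set" and E' :: "'f set" and r' s' :: "'f \<Rightarrow> 'w"
  assumes "countable_digraph V E r s"
    and "countable_digraph V' E' r' s'"
  shows "(\<exists>\<tau>. bicont_alg_iso (paths V E r s) (paths V' E' r' s')
                (tensor_alg V E r s) (tensor_alg V' E' r' s') \<tau>)
         \<longleftrightarrow> graph_iso V E r s V' E' r' s'"
proof
  assume "\<exists>\<tau>. bicont_alg_iso (paths V E r s) (paths V' E' r' s')
                (tensor_alg V E r s) (tensor_alg V' E' r' s') \<tau>"
  then obtain \<tau> where "bicont_alg_iso (paths V E r s) (paths V' E' r' s')
                (tensor_alg V E r s) (tensor_alg V' E' r' s') \<tau>" by blast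
  then have "tensor_iso V E r s V' E' r' s' \<tau>"
    using assms by (simp add: tensor_iso_def tensor_iso_axioms_def digraph_def)
  then show "graph_iso V E r s V' E' r' s'"
    \<comment> \<open>The graph isomorphism obtained from \<tau> runs backwards, hence the use of
      the inverse.\<close>
    by (rule tensor_iso.graph_iso[OF tensor_iso.inverse_iso])
qed (rule graph_iso_imp_tensor_iso[OF assms])

end
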